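(* Let $k$ be a field. The stabilized operads $\mathcal{C}omm_{\mathrm{st}}$ and $\mathcal{C}omm_{\mathrm{st}}^\dagger$ are isomorphic to the constant operads $\mathcal{C}onst$ and $\mathcal{C}onst^\dagger$, respectively.
   Context: $k[d]$ is $k$ concentrated in degree $d$; $X[n]_d=X_{d-n}$. The commutativity chain operad $\mathcal{C}omm$ over $k$ has $\mathcal{C}omm(n)=k[0]$ for all $n\ge0$ with the evident structure. The constant chain operad $\mathcal{C}onst$ has $\mathcal{C}onst(1)=k[0]$ and $\mathcal{C}onst(n)=0$ for $n\ne1$, with the evident structure. The operadic suspension of a chain operad $\mathcal{P}$ is $\Sigma\mathcal{P}=\mathcal{P}\otimes_k\mathcal{E}nd_{k[1]}$ (aritywise tensor with the endomorphism operad of $k[1]$), so $(\Sigma^r\mathcal{P})(n)\cong\mathcal{P}(n)[r-rn]$. The stabilization map $\Psi\colon\Sigma\mathcal{C}omm\to\mathcal{C}omm$ is the map which is zero in each arity except arity one, where it is the identity of $k[0]$. The stable commutativity chain operad is the inverse limit $\mathcal{C}omm_{\mathrm{st}}=\lim(\cdots\xrightarrow{\Sigma^2\Psi}\Sigma^2\mathcal{C}omm\xrightarrow{\Sigma\Psi}\Sigma\mathcal{C}omm\xrightarrow{\Psi}\mathcal{C}omm)$ (limits of operads are formed arity by arity). For a chain complex $X$, $X^\dagger$ is the cochain complex with $(X^\dagger)^d=X_{-d}$, applied aritywise to operads; $\mathcal{C}omm_{\mathrm{st}}^\dagger=(\mathcal{C}omm_{\mathrm{st}})^\dagger$ and $\mathcal{C}onst^\dagger$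 is the cochain operad associated to $\mathcal{C}onst$. *)

theory Defs
  imports Complex_Main "HOL-Library.Function_Algebras" "HOL-Combinatorics.Permutations"
begin

section \<open>Vector spaces\<close>

text \<open>
  A vector space over the field \<^typ>\<open>'k\<close> is a linear subspace of a function space
  \<^typ>\<open>'i \<Rightarrow> 'k\<close>; by the existence of bases, every vector space is isomorphic to one of this form.
  Vector space structures on function spaces are pointwise.
\<close>

definition scl :: "'k::field \<Rightarrow> ('i \<Rightarrow> 'k) \<Rightarrow> ('i \<Rightarrow> 'k)" where
  "scl c x = (\<lambda>i. c * x i)"

global_interpretation fs: vector_space "scl :: 'k::field \<Rightarrow> ('i \<Rightarrow> 'k) \<Rightarrow> _"
  by unfold_locales (auto simp: scl_def fun_eq_iff algebra_simps)

definition linear_on :: "('i \<Rightarrow> 'k::field) set \<Rightarrow> (('i \<Rightarrow> 'k) \<Rightarrow> ('j \<Rightarrow> 'k)) \<Rightarrow> bool" where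
  "linear_on V f \<longleftrightarrow> (\<forall>x\<in>V. \<forall>y\<in>V. f (x + y) = f x + f y) \<and> (\<forall>c. \<forall>x\<in>V. f (scl c x) = scl c (f x))"

definition bilinear_on :: "('i \<Rightarrow> 'k::field) set \<Rightarrow> ('j \<Rightarrow> 'k) set
    \<Rightarrow> (('i \<Rightarrow> 'k) \<Rightarrow> ('j \<Rightarrow> 'k) \<Rightarrow> ('l \<Rightarrow> 'k)) \<Rightarrow> bool" where
  "bilinear_on V W f \<longleftrightarrow> (\<forall>x\<in>V. linear_on W (f x)) \<and> (\<forall>y\<in>W. linear_on V (\<lambda>x. f x y))"


section \<open>Complexes and operads\<close>

text \<open>
  Differentials have degree \<open>s\<close>, where \<open>s = -1\<close> for chain complexes and \<open>s = 1\<close> for cochain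
  complexes.  All the operations carry the degrees of their arguments as extra parameters; only
  their values on elements of the indicated degrees matter.
\<close>

record ('k, 'i) cpx =
  grade :: "int \<Rightarrow> ('i \<Rightarrow> 'k) set"
  bdry :: "int \<Rightarrow> ('i \<Rightarrow> 'k) \<Rightarrow> ('i \<Rightarrow> 'k)"

locale dg_complex =
  fixes s :: int and C :: "('k::field, 'i) cpx"
  assumes subspace_grade: "fs.subspace (grade C d)"
    and bdry_closed: "x \<in> grade C d \<Longrightarrow> bdry C d x \<in> grade C (d + s)"
    and bdry_linear: "linear_on (grade C d) (bdry C d)"
    and bdry_bdry: "x \<in> grade C d \<Longrightarrow> bdry C (d + s) (bdry C d x) = 0"

text \<open>
  Symmetric operads are presented by partial compositions: \<open>op_comp P m n i d e x y\<close> is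
  \<open>x \<circ>\<^sub>i y\<close> for \<open>x\<close> of arity \<open>m\<close> and degree \<open>d\<close> and \<open>y\<close> of arity \<open>n\<close> and degree \<open>e\<close>.
  Inputs are numbered from \<open>0\<close>.  The term \<open>op_act P n \<sigma> d x\<close> is \<open>x \<sigma>\<close>
  for the right action of permutations of \<open>{..<n}\<close>, where input \<open>p\<close> of \<open>x \<sigma>\<close> is input \<open>\<sigma> p\<close> of \<open>x\<close>.
\<close>

record ('k, 'i) dgop =
  op_ar :: "nat \<Rightarrow> ('k, 'i) cpx"
  op_act :: "nat \<Rightarrow> (nat \<Rightarrow> nat) \<Rightarrow> int \<Rightarrow> ('i \<Rightarrow> 'k) \<Rightarrow> ('i \<Rightarrow> 'k)"
  op_comp :: "nat \<Rightarrow> nat \<Rightarrow> nat \<Rightarrow> int \<Rightarrow> int \<Rightarrow> ('i \<Rightarrow> 'k) \<Rightarrow> ('i \<Rightarrow> 'k) \<Rightarrow> ('i \<Rightarrow> 'k)"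
  op_unit :: "'i \<Rightarrow> 'k"

abbreviation op_gr :: "('k, 'i) dgop \<Rightarrow> nat \<Rightarrow> int \<Rightarrow> ('i \<Rightarrow> 'k) set" where
  "op_gr P n \<equiv> grade (op_ar P n)"

abbreviation op_bd :: "('k, 'i) dgop \<Rightarrow> nat \<Rightarrow> int \<Rightarrow> ('i \<Rightarrow> 'k) \<Rightarrow> ('i \<Rightarrow> 'k)" where
  "op_bd P n \<equiv> bdry (op_ar P n)"

text \<open>
  The permutation of \<open>{..<m + n - 1}\<close> for which \<open>(x \<sigma>) \<circ>\<^sub>i (y \<tau>) = (x \<circ>\<^bsub>\<sigma> i\<^esub> y) (perm_comp m n i \<sigma> \<tau>)\<close>,
  where \<open>x\<close> has arity \<open>m\<close> and \<open>y\<close> has arity \<open>n\<close>.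
\<close>

definition perm_comp :: "nat \<Rightarrow> nat \<Rightarrow> nat \<Rightarrow> (nat \<Rightarrow> nat) \<Rightarrow> (nat \<Rightarrow> nat) \<Rightarrow> nat \<Rightarrow> nat" where
  "perm_comp m n i \<sigma> \<tau> p =
    (let shift = (\<lambda>a. if a < \<sigma> i then a else a + n - 1)
     in if p < i then shift (\<sigma> p)
        else if p < i + n then \<sigma> i + \<tau> (p - i)
        else if p < m + n - 1 then shift (\<sigma> (p + 1 - n))
        else p)"

locale dg_operad =
  fixes s :: int and P :: "('k::field, 'i) dgop"
  assumes ar_complex: "dg_complex s (op_ar P n)"
    and act_closed: "\<sigma> permutes {..<n} \<Longrightarrow> x \<in> op_gr P n d \<Longrightarrow> op_act P n \<sigma> d x \<in> op_gr P n d"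
    and act_linear: "\<sigma> permutes {..<n} \<Longrightarrow> linear_on (op_gr P n d) (op_act P n \<sigma> d)"
    and act_bdry: "\<sigma> permutes {..<n} \<Longrightarrow> x \<in> op_gr P n d \<Longrightarrow>
      op_act P n \<sigma> (d + s) (op_bd P n d x) = op_bd P n d (op_act P n \<sigma> d x)"
    and act_id: "x \<in> op_gr P n d \<Longrightarrow> op_act P n id d x = x"
    and act_act: "\<sigma> permutes {..<n} \<Longrightarrow> \<tau> permutes {..<n} \<Longrightarrow> x \<in> op_gr P n d \<Longrightarrow>
      op_act P n \<tau> d (op_act P n \<sigma> d x) = op_act P n (\<sigma> \<circ> \<tau>) d x"
    and comp_closed: "i < m \<Longrightarrow> x \<in> op_gr P m d \<Longrightarrow> y \<in> op_gr P n e \<Longrightarrow>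
      op_comp P m n i d e x y \<in> op_gr P (m + n - 1) (d + e)"
    and comp_bilinear: "i < m \<Longrightarrow> bilinear_on (op_gr P m d) (op_gr P n e) (op_comp P m n i d e)"
    and comp_bdry: "i < m \<Longrightarrow> x \<in> op_gr P m d \<Longrightarrow> y \<in> op_gr P n e \<Longrightarrow>
      op_bd P (m + n - 1) (d + e) (op_comp P m n i d e x y) =
      op_comp P m n i (d + s) e (op_bd P m d x) y +
      scl ((-1) powi d) (op_comp P m n i d (e + s) x (op_bd P n e y))"
    and unit_closed: "op_unit P \<in> op_gr P 1 0"
    and unit_bdry: "op_bd P 1 0 (op_unit P) = 0"
    and unit_left: "x \<in> op_gr P n d \<Longrightarrow> op_comp P 1 n 0 0 d (op_unit P) x = x"
    and unit_right: "i < n \<Longrightarrow> x \<in> op_gr P n d \<Longrightarrow> op_comp P n 1 i d 0 x (op_unit P) = x"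
    and comp_sequential: "i < l \<Longrightarrow> j < m \<Longrightarrow>
      x \<in> op_gr P l d \<Longrightarrow> y \<in> op_gr P m e \<Longrightarrow> z \<in> op_gr P n f \<Longrightarrow>
      op_comp P (l + m - 1) n (i + j) (d + e) f (op_comp P l m i d e x y) z =
      op_comp P l (m + n - 1) i d (e + f) x (op_comp P m n j e f y z)"
    and comp_parallel: "i < j \<Longrightarrow> j < l \<Longrightarrow>
      x \<in> op_gr P l d \<Longrightarrow> y \<in> op_gr P m e \<Longrightarrow> z \<in> op_gr P n f \<Longrightarrow>
      op_comp P (l + m - 1) n (j + m - 1) (d + e) f (op_comp P l m i d e x y) z =
      scl ((-1) powi (e * f))
        (op_comp P (l + n - 1) m i (d + f) e (op_comp P l n j d f x z) y)"
    and comp_equivariant: "i < m \<Longrightarrow> \<sigma> permutes {..<m} \<Longrightarrow> \<tau> permutes {..<n} \<Longrightarrow>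
      x \<in> op_gr P m d \<Longrightarrow> y \<in> op_gr P n e \<Longrightarrow>
      op_comp P m n i d e (op_act P m \<sigma> d x) (op_act P n \<tau> e y) =
      op_act P (m + n - 1) (perm_comp m n i \<sigma> \<tau>) (d + e) (op_comp P m n (\<sigma> i) d e x y)"

type_synonym ('k, 'i, 'j) opmap = "nat \<Rightarrow> int \<Rightarrow> ('i \<Rightarrow> 'k) \<Rightarrow> ('j \<Rightarrow> 'k)"

locale dg_operad_hom =
  fixes s :: int and P :: "('k::field, 'i) dgop" and Q :: "('k, 'j) dgop"
    and \<phi> :: "('k, 'i, 'j) opmap"
  assumes hom_closed: "x \<in> op_gr P n d \<Longrightarrow> \<phi> n d x \<in> op_gr Q n d"
    and hom_linear: "linear_on (op_gr P n d) (\<phi> n d)"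
    and hom_bdry: "x \<in> op_gr P n d \<Longrightarrow> \<phi> n (d + s) (op_bd P n d x) = op_bd Q n d (\<phi> n d x)"
    and hom_act: "\<sigma> permutes {..<n} \<Longrightarrow> x \<in> op_gr P n d \<Longrightarrow>
      \<phi> n d (op_act P n \<sigma> d x) = op_act Q n \<sigma> d (\<phi> n d x)"
    and hom_comp: "i < m \<Longrightarrow> x \<in> op_gr P m d \<Longrightarrow> y \<in> op_gr P n e \<Longrightarrow>
      \<phi> (m + n - 1) (d + e) (op_comp P m n i d e x y) =
      op_comp Q m n i d e (\<phi> m d x) (\<phi> n e y)"
    and hom_unit: "\<phi> 1 0 (op_unit P) = op_unit Q"

definition dg_operad_iso :: "int \<Rightarrow> ('k::field, 'i) dgop \<Rightarrow> ('k, 'j) dgop \<Rightarrow> bool" where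
  "dg_operad_iso s P Q \<longleftrightarrow> dg_operad s P \<and> dg_operad s Q \<and>
    (\<exists>\<phi>. dg_operad_hom s P Q \<phi> \<and> (\<forall>n d. bij_betw (\<phi> n d) (op_gr P n d) (op_gr Q n d)))"

abbreviation chain_operad_iso :: "('k::field, 'i) dgop \<Rightarrow> ('k, 'j) dgop \<Rightarrow> bool" where
  "chain_operad_iso \<equiv> dg_operad_iso (-1)"

abbreviation cochain_operad_iso :: "('k::field, 'i) dgop \<Rightarrow> ('k, 'j) dgop \<Rightarrow> bool" where
  "cochain_operad_iso \<equiv> dg_operad_iso 1"

definition dagger :: "('k, 'i) cpx \<Rightarrow> ('k, 'i) cpx" where
  "dagger X = \<lparr>grade = (\<lambda>d. grade X (- d)), bdry = (\<lambda>d. bdry X (- d))\<rparr>"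

definition op_dagger :: "('k, 'i) dgop \<Rightarrow> ('k, 'i) dgop" where
  "op_dagger P = \<lparr>
    op_ar = (\<lambda>n. dagger (op_ar P n)),
    op_act = (\<lambda>n \<sigma> d. op_act P n \<sigma> (- d)),
    op_comp = (\<lambda>m n i d e. op_comp P m n i (- d) (- e)),
    op_unit = op_unit P\<rparr>"


section \<open>The commutativity operad and the constant operad\<close>

definition conc :: "int \<Rightarrow> ('k::field, unit) cpx" where
  "conc a = \<lparr>grade = (\<lambda>d. if d = a then UNIV else {0}), bdry = (\<lambda>d x. 0)\<rparr>"

definition zero_cpx :: "('k::field, 'i) cpx" where
  "zero_cpx = \<lparr>grade = (\<lambda>d. {0}), bdry = (\<lambda>d x. 0)\<rparr>"

definition comm_op :: "('k::field, unit) dgop" where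
  "comm_op = \<lparr>
    op_ar = (\<lambda>n. conc 0),
    op_act = (\<lambda>n \<sigma> d x. x),
    op_comp = (\<lambda>m n i d e x y. \<lambda>u. x u * y u),
    op_unit = (\<lambda>u. 1)\<rparr>"

definition const_op :: "('k::field, unit) dgop" where
  "const_op = \<lparr>
    op_ar = (\<lambda>n. if n = 1 then conc 0 else zero_cpx),
    op_act = (\<lambda>n \<sigma> d x. x),
    op_comp = (\<lambda>m n i d e x y. \<lambda>u. x u * y u),
    op_unit = (\<lambda>u. 1)\<rparr>"

lemma comm_op: "dg_operad (-1) (comm_op :: ('k::field, unit) dgop)"
  by (unfold_locales; auto simp: comm_op_def conc_def linear_on_def bilinear_on_def scl_def
      fun_eq_iff algebra_simps fs.subspace_def split: if_splits)

lemma const_op: "dg_operad (-1) (const_op :: ('k::field, unit) dgop)"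
  by (unfold_locales; auto simp: const_op_def conc_def zero_cpx_def linear_on_def bilinear_on_def scl_def
      fun_eq_iff algebra_simps fs.subspace_def split: if_splits)


section \<open>Endomorphism operads\<close>

text \<open>
  The element \<open>x\<^sub>1 \<otimes> \<dots> \<otimes> x\<^sub>n\<close> of a tensor power, for a list of pairs \<open>(|x\<^sub>j|, x\<^sub>j)\<close>.  An element of
  the \<open>n\<close>-th tensor power is given by its coordinates at the lists of \<open>n\<close> pairs consisting of a
  degree and an index.
\<close>

fun ptens :: "(int \<times> ('i \<Rightarrow> 'k::field)) list \<Rightarrow> ((int \<times> 'i) list \<Rightarrow> 'k)" where
  "ptens [] [] = 1"
| "ptens ((a, x) # xs) ((b, i) # is) = (if a = b then x i * ptens xs is else 0)"
| "ptens _ _ = 0"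

definition degsum :: "(int \<times> 'a) list \<Rightarrow> int" where
  "degsum xs = sum_list (map fst xs)"

definition hom_lists :: "('k, 'i) cpx \<Rightarrow> nat \<Rightarrow> int \<Rightarrow> (int \<times> ('i \<Rightarrow> 'k)) list set" where
  "hom_lists X n d = {xs. length xs = n \<and> (\<forall>(a, x)\<in>set xs. x \<in> grade X a) \<and> degsum xs = d}"

text \<open>
  Here and below, maps on tensor products and tensor powers are determined by their values on pure
  tensors together with (bi)linearity, and are written with \<open>SOME\<close> or \<open>THE\<close>.
\<close>

definition tpow :: "('k::field, 'i) cpx \<Rightarrow> nat \<Rightarrow> ('k, (int \<times> 'i) list) cpx" where
  "tpow X n = (let V = (\<lambda>d. fs.span (ptens ` hom_lists X n d)) in \<lparr>
    grade = V,
    bdry = (\<lambda>d. SOME D. linear_on (V d) D \<and> (\<forall>xs \<in> hom_lists X n d. D (ptens xs) =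
      (\<Sum>j<n. case xs ! j of (a, x) \<Rightarrow>
        scl ((-1) powi degsum (take j xs)) (ptens (xs[j := (a - 1, bdry X a x)])))))\<rparr>)"

text \<open>
  An element of degree \<open>d\<close> of \<open>Hom(A, B)\<close> is a family of linear maps \<open>hap F a : A\<^sub>a \<rightarrow> B\<^bsub>a + d\<^esub>\<close>, each
  extended by zero outside \<open>A\<^sub>a\<close>.
\<close>

definition hap :: "(int \<times> ('i \<Rightarrow> 'k) \<times> 'j \<Rightarrow> 'k) \<Rightarrow> int \<Rightarrow> ('i \<Rightarrow> 'k) \<Rightarrow> ('j \<Rightarrow> 'k)" where
  "hap F a x = (\<lambda>j. F (a, x, j))"

definition hom_cpx :: "('k::field, 'i) cpx \<Rightarrow> ('k, 'j) cpx \<Rightarrow> ('k, int \<times> ('i \<Rightarrow> 'k) \<times> 'j) cpx" where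
  "hom_cpx A B = \<lparr>
    grade = (\<lambda>d. {F. \<forall>a. linear_on (grade A a) (hap F a) \<and>
      (\<forall>x \<in> grade A a. hap F a x \<in> grade B (a + d)) \<and> (\<forall>x. x \<notin> grade A a \<longrightarrow> hap F a x = 0)}),
    bdry = (\<lambda>d F. \<lambda>(a, x, j). if x \<in> grade A a
      then (bdry B (a + d) (hap F a x) - scl ((-1) powi d) (hap F (a - 1) (bdry A a x))) j
      else 0)\<rparr>"

text \<open>The Koszul sign of the rearrangement which moves \<open>x\<^sub>p\<close> to position \<open>\<sigma> p\<close>.\<close>

definition koszul :: "(nat \<Rightarrow> nat) \<Rightarrow> (int \<times> ('i \<Rightarrow> 'k)) list \<Rightarrow> 'k::field" where
  "koszul \<sigma> xs = (\<Prod>(p, q) \<in> {(p, q). p < q \<and> q < length xs \<and> \<sigma> q < \<sigma> p}.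
    (-1) powi (fst (xs ! p) * fst (xs ! q)))"

text \<open>
  In a partial composition the degree \<open>e\<close> map \<open>G\<close> is applied to the block \<open>ys\<close> of inputs after
  moving past the inputs preceding it.
\<close>

definition end_op :: "('k::field, 'i) cpx \<Rightarrow> ('k, int \<times> ((int \<times> 'i) list \<Rightarrow> 'k) \<times> 'i) dgop" where
  "end_op X = (let E = (\<lambda>n. hom_cpx (tpow X n) X) in \<lparr>
    op_ar = E,
    op_act = (\<lambda>n \<sigma> d F. THE G. G \<in> grade (E n) d \<and>
      (\<forall>a. \<forall>xs \<in> hom_lists X n a. hap G a (ptens xs) =
        scl (koszul \<sigma> xs) (hap F a (ptens (map (\<lambda>q. xs ! inv \<sigma> q) [0..<n]))))),
    op_comp = (\<lambda>m n i d e F G. THE H. H \<in> grade (E (m + n - 1)) (d + e) \<and>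
      (\<forall>a. \<forall>xs \<in> hom_lists X (m + n - 1) a. hap H a (ptens xs) =
        (let ys = take n (drop i xs); b = degsum ys in
          scl ((-1) powi (e * degsum (take i xs)))
            (hap F (a + e) (ptens (take i xs @ (b + e, hap G b (ptens ys)) # drop (i + n) xs)))))),
    op_unit = (THE U. U \<in> grade (E 1) 0 \<and>
      (\<forall>a. \<forall>x \<in> grade X a. hap U a (ptens [(a, x)]) = x))\<rparr>)"


section \<open>Tensor products\<close>

text \<open>
  For subspaces \<open>V\<close> and \<open>W\<close> of function spaces on index types \<^typ>\<open>'i\<close> and \<^typ>\<open>'j\<close>, the tensor product
  \<open>V \<otimes> W\<close> is the span of the functions \<open>(i, j) \<mapsto> x i * y j\<close>.  The extra index of type \<^typ>\<open>int\<close> separates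
  the summands of \<open>(A \<otimes> B)\<^sub>d = \<Oplus>\<^sub>a A\<^sub>a \<otimes> B\<^bsub>d - a\<^esub>\<close>.  The lemmas \<open>tensor_lift_universal\<close>
  and \<open>tensor_lift2\<close> below are its universal property.
\<close>

definition pten :: "int \<Rightarrow> ('i \<Rightarrow> 'k::field) \<Rightarrow> ('j \<Rightarrow> 'k) \<Rightarrow> (int \<times> 'i \<times> 'j \<Rightarrow> 'k)" where
  "pten a x y = (\<lambda>(a', i, j). if a' = a then x i * y j else 0)"

definition tensor_gr :: "('k::field, 'i) cpx \<Rightarrow> ('k, 'j) cpx \<Rightarrow> int \<Rightarrow> (int \<times> 'i \<times> 'j \<Rightarrow> 'k) set" where
  "tensor_gr A B d = fs.span {pten a x y | a x y. x \<in> grade A a \<and> y \<in> grade B (d - a)}"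

definition tensor_lift :: "('k::field, 'i) cpx \<Rightarrow> ('k, 'j) cpx \<Rightarrow> int
    \<Rightarrow> (int \<Rightarrow> ('i \<Rightarrow> 'k) \<Rightarrow> ('j \<Rightarrow> 'k) \<Rightarrow> ('l \<Rightarrow> 'k)) \<Rightarrow> (int \<times> 'i \<times> 'j \<Rightarrow> 'k) \<Rightarrow> ('l \<Rightarrow> 'k)" where
  "tensor_lift A B d \<beta> = (SOME f. linear_on (tensor_gr A B d) f \<and>
    (\<forall>a. \<forall>x \<in> grade A a. \<forall>y \<in> grade B (d - a). f (pten a x y) = \<beta> a x y))"

definition tensor_cpx :: "('k::field, 'i) cpx \<Rightarrow> ('k, 'j) cpx \<Rightarrow> ('k, int \<times> 'i \<times> 'j) cpx" where
  "tensor_cpx A B = \<lparr>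
    grade = tensor_gr A B,
    bdry = (\<lambda>d. tensor_lift A B d (\<lambda>a x y.
      pten (a - 1) (bdry A a x) y + scl ((-1) powi a) (pten a x (bdry B (d - a) y))))\<rparr>"

definition tensor_op :: "('k::field, 'i) dgop \<Rightarrow> ('k, 'j) dgop \<Rightarrow> ('k, int \<times> 'i \<times> 'j) dgop" where
  "tensor_op P Q = \<lparr>
    op_ar = (\<lambda>n. tensor_cpx (op_ar P n) (op_ar Q n)),
    op_act = (\<lambda>n \<sigma> d. tensor_lift (op_ar P n) (op_ar Q n) d (\<lambda>a x y.
      pten a (op_act P n \<sigma> a x) (op_act Q n \<sigma> (d - a) y))),
    op_comp = (\<lambda>m n i d e. SOME f.
      bilinear_on (tensor_gr (op_ar P m) (op_ar Q m) d) (tensor_gr (op_ar P n) (op_ar Q n) e) f \<and>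
      (\<forall>a b. \<forall>x \<in> op_gr P m a. \<forall>y \<in> op_gr Q m (d - a). \<forall>z \<in> op_gr P n b. \<forall>w \<in> op_gr Q n (e - b).
        f (pten a x y) (pten b z w) = scl ((-1) powi ((d - a) * b))
          (pten (a + b) (op_comp P m n i a b x z) (op_comp Q m n i (d - a) (e - b) y w)))),
    op_unit = pten 0 (op_unit P) (op_unit Q)\<rparr>"

definition tensor_map :: "('k::field, 'i) dgop \<Rightarrow> ('k, 'j) dgop
    \<Rightarrow> ('k, 'i, 'l) opmap \<Rightarrow> ('k, 'j, 'm) opmap \<Rightarrow> ('k, int \<times> 'i \<times> 'j, int \<times> 'l \<times> 'm) opmap" where
  "tensor_map P Q \<phi> \<psi> n d = tensor_lift (op_ar P n) (op_ar Q n) d (\<lambda>a x y.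
    pten a (\<phi> n a x) (\<psi> n (d - a) y))"


subsection \<open>Extension of bilinear maps to tensor products\<close>

lemma linear_onD: "linear_on V f \<Longrightarrow> x \<in> V \<Longrightarrow> y \<in> V \<Longrightarrow> f (x + y) = f x + f y"
  "linear_on V f \<Longrightarrow> x \<in> V \<Longrightarrow> f (scl c x) = scl c (f x)"
  by (auto simp: linear_on_def)

lemma linear_on_zero: "linear_on V f \<Longrightarrow> 0 \<in> V \<Longrightarrow> f 0 = 0"
  using linear_onD(2)[of V f 0 0] by simp

lemma linear_on_span_eq:
  assumes "linear_on (fs.span G) f" "linear_on (fs.span G) g" "\<And>x. x \<in> G \<Longrightarrow> f x = g x" "x \<in> fs.span G"
  shows "f x = g x"
proof -
  have "x \<in> fs.span G \<and> f x = g x"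
    using assms(4)
  proof (induction rule: fs.span_induct_alt)
    case base
    then show ?case using assms(1,2) linear_on_zero fs.span_zero by metis
  next
    case (step c x y)
    have x: "x \<in> fs.span G" using step by (simp add: fs.span_base)
    have sc: "scl c x \<in> fs.span G" using x by (rule fs.span_scale)
    have y: "y \<in> fs.span G" "f y = g y" using step by auto
    have "f (scl c x + y) = scl c (f x) + f y"
      using linear_onD(1)[OF assms(1) sc y(1)] linear_onD(2)[OF assms(1) x, of c] by metis
    moreover have "g (scl c x + y) = scl c (g x) + g y"
      using linear_onD(1)[OF assms(2) sc y(1)] linear_onD(2)[OF assms(2) x, of c] by metis
    ultimately show ?case using assms(3)[of x] step(1) y fs.span_add[OF sc y(1)] by metis
  qed
  then show ?thesis by simp
qed

lemma pten_add1: "pten a (x + x') y = pten a x y + pten a x' y"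
  and pten_add2: "pten a x (y + y') = pten a x y + pten a x y'"
  and pten_scl1: "pten a (scl c x) y = scl c (pten a x y)"
  and pten_scl2: "pten a x (scl c y) = scl c (pten a x y)"
  by (auto simp: pten_def scl_def fun_eq_iff algebra_simps)

lemma pten_zero[simp]: "pten a 0 y = 0" "pten a x 0 = 0"
  by (auto simp: pten_def fun_eq_iff)

lemma tensor_lift_exists:
  fixes A :: "('k::field, 'i) cpx" and B :: "('k, 'j) cpx"
  assumes A: "\<And>a. fs.subspace (grade A a)" and B: "\<And>a. fs.subspace (grade B a)"
    and \<beta>: "\<And>a. bilinear_on (grade A a) (grade B (d - a)) (\<beta> a)"
  shows "\<exists>f. linear_on (tensor_gr A B d) f \<and>
    (\<forall>a. \<forall>x \<in> grade A a. \<forall>y \<in> grade B (d - a). f (pten a x y) = (\<beta> a x y :: 'l \<Rightarrow> 'k))"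
proof -
  have "\<forall>a. \<exists>S. S \<subseteq> grade A a \<and> fs.independent S \<and> grade A a = fs.span S"
  proof
    fix a show "\<exists>S. S \<subseteq> grade A a \<and> fs.independent S \<and> grade A a = fs.span S"
  proof -
    obtain S where S: "S \<subseteq> grade A a" "fs.independent S" "grade A a \<subseteq> fs.span S"
      by (rule fs.basis_exists[of "grade A a"])
    moreover have "fs.span S \<subseteq> grade A a" by (rule fs.span_minimal[OF S(1) A])
    ultimately show ?thesis by blast
  qed
  qed
  from choice[OF this] obtain U where U: "\<And>a. U a \<subseteq> grade A a" "\<And>a. fs.independent (U a)" "\<And>a. grade A a = fs.span (U a)"
    by blast
  have "\<forall>a. \<exists>S. S \<subseteq> grade B a \<and> fs.independent S \<and> grade B a = fs.span S"
  proof
    fix a show "\<exists>S. S \<subseteq> grade B a \<and> fs.independent S \<and> grade B a = fs.span S"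
  proof -
    obtain S where S: "S \<subseteq> grade B a" "fs.independent S" "grade B a \<subseteq> fs.span S"
      by (rule fs.basis_exists[of "grade B a"])
    moreover have "fs.span S \<subseteq> grade B a" by (rule fs.span_minimal[OF S(1) B])
    ultimately show ?thesis by blast
  qed
  qed
  from choice[OF this] obtain W where W: "\<And>a. W a \<subseteq> grade B a" "\<And>a. fs.independent (W a)" "\<And>a. grade B a = fs.span (W a)"
    by blast
  define RU where "RU a x u = fs.representation (fs.extend_basis (U a)) x u" for a x u
  define RW where "RW a x u = fs.representation (fs.extend_basis (W a)) x u" for a x u
  have RU_add: "RU a (x + y) u = RU a x u + RU a y u" and RU_scl: "RU a (scl c x) u = c * RU a x u" for a x y u c
    unfolding RU_def using fs.independent_extend_basis[OF U(2)] fs.span_extend_basis[OF U(2)]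
    by (simp_all add: fs.representation_add fs.representation_scale)
  have RW_add: "RW a (x + y) u = RW a x u + RW a y u" and RW_scl: "RW a (scl c x) u = c * RW a x u" for a x y u c
    unfolding RW_def using fs.independent_extend_basis[OF W(2)] fs.span_extend_basis[OF W(2)]
    by (simp_all add: fs.representation_add fs.representation_scale)
  have RU_basis: "RU a x u = (if u = x then 1 else 0)" if "x \<in> U a" for a x u
    unfolding RU_def using fs.independent_extend_basis[OF U(2)] fs.extend_basis_superset[OF U(2)] that
    by (subst fs.representation_basis) auto
  have RW_basis: "RW a x u = (if u = x then 1 else 0)" if "x \<in> W a" for a x u
    unfolding RW_def using fs.independent_extend_basis[OF W(2)] fs.extend_basis_superset[OF W(2)] that
    by (subst fs.representation_basis) auto
  define \<Phi> where "\<Phi> a u w t = RU a (\<lambda>i. RW (d - a) (\<lambda>j. t (a, i, j)) w) u" for a u w and t :: "int \<times> 'i \<times> 'j \<Rightarrow> 'k"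
  have \<Phi>_add: "\<Phi> a u w (s + t) = \<Phi> a u w s + \<Phi> a u w t" for a u w s t
  proof -
    have "(\<lambda>i. RW (d - a) (\<lambda>j. (s + t) (a, i, j)) w)
      = (\<lambda>i. RW (d - a) (\<lambda>j. s (a, i, j)) w) + (\<lambda>i. RW (d - a) (\<lambda>j. t (a, i, j)) w)"
      by (auto simp: fun_eq_iff plus_fun_def simp flip: RW_add)
    then show ?thesis unfolding \<Phi>_def by (simp add: RU_add)
  qed
  have \<Phi>_scl: "\<Phi> a u w (scl c t) = c * \<Phi> a u w t" for a u w c t
  proof -
    have "(\<lambda>i. RW (d - a) (\<lambda>j. (scl c t) (a, i, j)) w)
      = scl c (\<lambda>i. RW (d - a) (\<lambda>j. t (a, i, j)) w)"
      by (auto simp: fun_eq_iff scl_def simp flip: RW_scl)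
    then show ?thesis unfolding \<Phi>_def by (simp add: RU_scl)
  qed
  have \<Phi>_pten: "\<Phi> a u w (pten b x y) = (if a = b then RU a x u * RW (d - a) y w else 0)" for a u w b x y
  proof -
    have e: "(\<lambda>j. pten b x y (a, i, j)) = scl (if a = b then x i else 0) y" for i
      by (auto simp: pten_def scl_def)
    have "(\<lambda>i. RW (d - a) (\<lambda>j. pten b x y (a, i, j)) w) = scl (if a = b then RW (d - a) y w else 0) x"
      unfolding e RW_scl by (auto simp: scl_def)
    then show ?thesis unfolding \<Phi>_def by (simp only: RU_scl) auto
  qed
  define T where "T = {(a, u, w). u \<in> U a \<and> w \<in> W (d - a)}"
  define p where "p = (\<lambda>(a, u, w). pten a u w :: int \<times> 'i \<times> 'j \<Rightarrow> 'k)"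
  define \<Psi> where "\<Psi> = (\<lambda>(a, u, w). \<Phi> a u w)"
  have dual: "\<Psi> q (p q') = (if q = q' then 1 else 0)" if "q' \<in> T" "q \<in> T" for q q'
    using that by (auto simp: T_def p_def \<Psi>_def \<Phi>_pten RU_basis RW_basis split: if_splits)
  have injp: "inj_on p T"
    by (rule inj_onI) (metis dual zero_neq_one)
  have indep: "fs.independent (p ` T)"
  proof
    assume "fs.dependent (p ` T)"
    then obtain q where q: "q \<in> T" "p q \<in> fs.span (p ` T - {p q})"
      unfolding fs.dependent_def by auto
    have "\<Psi> q t = 0" if "t \<in> fs.span (p ` T - {p q})" for t
      using that
    proof (induction rule: fs.span_induct_alt)
      case base
      show ?case using \<Phi>_scl[of _ _ _ 0 0] by (cases q) (simp add: \<Psi>_def del: zero_fun_apply)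
    next
      case (step c x y)
      then obtain q' where "q' \<in> T" "x = p q'" "q' \<noteq> q" by auto
      then have "\<Psi> q x = 0" using dual q by metis
      then show ?case using step(2) by (cases q) (simp add: \<Psi>_def \<Phi>_add \<Phi>_scl del: plus_fun_apply)
    qed
    then show False using q dual[of q q] by simp
  qed
  interpret vp: vector_space_pair "scl :: 'k \<Rightarrow> (int \<times> 'i \<times> 'j \<Rightarrow> 'k) \<Rightarrow> _" "scl :: 'k \<Rightarrow> ('l \<Rightarrow> 'k) \<Rightarrow> _" ..
  obtain F where F: "Vector_Spaces.linear scl scl F"
      "\<forall>x \<in> p ` T. F x = (\<lambda>(a, u, w). \<beta> a u w) (inv_into T p x)"
    using vp.linear_independent_extend[OF indep, of "\<lambda>x. (\<lambda>(a, u, w). \<beta> a u w) (inv_into T p x)"] by blast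
  have F_lin: "F (x + y) = F x + F y" "F (scl c x) = scl c (F x)" for x y c
    using F(1) vp.linear_add vp.linear_scale by auto
  have basis: "F (pten a u w) = \<beta> a u w" if "u \<in> U a" "w \<in> W (d - a)" for a u w
  proof -
    have "(a, u, w) \<in> T" using that by (simp add: T_def)
    then show ?thesis using F(2) injp inv_into_f_f[of p T "(a,u,w)"] by (force simp: p_def)
  qed
  have step1: "F (pten a x w) = \<beta> a x w" if x: "x \<in> grade A a" and w: "w \<in> W (d - a)" for a x w
  proof (rule linear_on_span_eq[of "U a"])
    show "linear_on (fs.span (U a)) (\<lambda>x. F (pten a x w))"
      by (simp add: linear_on_def pten_add1 pten_scl1 F_lin)
    show "linear_on (fs.span (U a)) (\<lambda>x. \<beta> a x w)"
      using \<beta>[of a] W(1) w U(3) unfolding bilinear_on_def by (metis subsetD)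
    show "x \<in> fs.span (U a)" using x U(3) by simp
  qed (use basis w in auto)
  have step2: "F (pten a x y) = \<beta> a x y" if x: "x \<in> grade A a" and y: "y \<in> grade B (d - a)" for a x y
  proof (rule linear_on_span_eq[of "W (d - a)"])
    show "linear_on (fs.span (W (d - a))) (\<lambda>y. F (pten a x y))"
      by (simp add: linear_on_def pten_add2 pten_scl2 F_lin)
    show "linear_on (fs.span (W (d - a))) (\<beta> a x)"
      using \<beta>[of a] x W(3) unfolding bilinear_on_def by metis
    show "y \<in> fs.span (W (d - a))" using y W(3) by simp
  qed (use step1 x in auto)
  have "linear_on (tensor_gr A B d) F" by (simp add: linear_on_def F_lin)
  with step2 show ?thesis by blast
qed

lemma tensor_lift_universal:
  fixes A :: "('k::field, 'i) cpx" and B :: "('k, 'j) cpx"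
    and \<beta> :: "int \<Rightarrow> ('i \<Rightarrow> 'k) \<Rightarrow> ('j \<Rightarrow> 'k) \<Rightarrow> ('l \<Rightarrow> 'k)"
  assumes A: "\<And>a. fs.subspace (grade A a)" and B: "\<And>a. fs.subspace (grade B a)"
    and \<beta>: "\<And>a. bilinear_on (grade A a) (grade B (d - a)) (\<beta> a)"
  shows "linear_on (tensor_gr A B d) (tensor_lift A B d \<beta>)"
    and "x \<in> grade A a \<Longrightarrow> y \<in> grade B (d - a) \<Longrightarrow> tensor_lift A B d \<beta> (pten a x y) = \<beta> a x y"
  using someI_ex[OF tensor_lift_exists[of A B d \<beta>, OF assms]] unfolding tensor_lift_def by blast+


lemma linear_on_add_scl:
  assumes "linear_on V f" "linear_on V g"
  shows "linear_on V (\<lambda>x. f x + g x)" "linear_on V (\<lambda>x. scl c (f x))"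
proof -
  show "linear_on V (\<lambda>x. f x + g x)"
    using assms by (auto simp: linear_on_def scl_def fun_eq_iff algebra_simps)
  show "linear_on V (\<lambda>x. scl c (f x))"
    using assms by (auto simp: linear_on_def scl_def fun_eq_iff algebra_simps)
qed

lemma tensor_lift2:
  fixes A :: "('k::field, 'i) cpx" and B :: "('k, 'j) cpx"
    and A' :: "('k, 'i') cpx" and B' :: "('k, 'j') cpx"
    and \<beta> :: "int \<Rightarrow> int \<Rightarrow> ('i \<Rightarrow> 'k) \<Rightarrow> ('j \<Rightarrow> 'k) \<Rightarrow> ('i' \<Rightarrow> 'k) \<Rightarrow> ('j' \<Rightarrow> 'k) \<Rightarrow> ('l \<Rightarrow> 'k)"
  assumes sub: "\<And>a. fs.subspace (grade A a)" "\<And>a. fs.subspace (grade B a)"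
      "\<And>a. fs.subspace (grade A' a)" "\<And>a. fs.subspace (grade B' a)"
    and lin: "\<And>a b z w. z \<in> grade A' b \<Longrightarrow> w \<in> grade B' (e - b) \<Longrightarrow>
        bilinear_on (grade A a) (grade B (d - a)) (\<lambda>x y. \<beta> a b x y z w)"
      "\<And>a b x y. x \<in> grade A a \<Longrightarrow> y \<in> grade B (d - a) \<Longrightarrow>
        bilinear_on (grade A' b) (grade B' (e - b)) (\<lambda>z w. \<beta> a b x y z w)"
  shows "\<exists>f. bilinear_on (tensor_gr A B d) (tensor_gr A' B' e) f \<and>
    (\<forall>a b. \<forall>x \<in> grade A a. \<forall>y \<in> grade B (d - a). \<forall>z \<in> grade A' b. \<forall>w \<in> grade B' (e - b).
      f (pten a x y) (pten b z w) = \<beta> a b x y z w)"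
proof -
  define g where "g a x y = tensor_lift A' B' e (\<lambda>b. \<beta> a b x y)" for a x y
  have g_lin: "linear_on (tensor_gr A' B' e) (g a x y)"
    and g_pten: "\<And>b z w. z \<in> grade A' b \<Longrightarrow> w \<in> grade B' (e - b) \<Longrightarrow> g a x y (pten b z w) = \<beta> a b x y z w"
    if "x \<in> grade A a" "y \<in> grade B (d - a)" for a x y
    using tensor_lift_universal[OF sub(3,4), of e "\<lambda>b. \<beta> a b x y", OF lin(2)[OF that]] by (simp_all add: g_def)
  have g_bil: "bilinear_on (grade A a) (grade B (d - a)) (\<lambda>x y. g a x y t)" if t: "t \<in> tensor_gr A' B' e" for a t
  proof -
    have eq: "f t = h t" if "linear_on (tensor_gr A' B' e) f" "linear_on (tensor_gr A' B' e) h"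
      "\<And>b z w. z \<in> grade A' b \<Longrightarrow> w \<in> grade B' (e - b) \<Longrightarrow> f (pten b z w) = h (pten b z w)" for f h :: "(int \<times> 'i' \<times> 'j' \<Rightarrow> 'k) \<Rightarrow> ('l \<Rightarrow> 'k)"
      using linear_on_span_eq[of _ f h t] that t unfolding tensor_gr_def by blast
    have b: "\<beta> a b (x + x') y z w = \<beta> a b x y z w + \<beta> a b x' y z w"
        "\<beta> a b (scl c x) y z w = scl c (\<beta> a b x y z w)"
      if "x \<in> grade A a" "x' \<in> grade A a" "y \<in> grade B (d - a)" "z \<in> grade A' b" "w \<in> grade B' (e - b)" for b c x x' y z w
      using lin(1)[OF that(4,5), of a] that unfolding bilinear_on_def linear_on_def by auto
    have b': "\<beta> a b x (y + y') z w = \<beta> a b x y z w + \<beta> a b x y' z w"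
        "\<beta> a b x (scl c y) z w = scl c (\<beta> a b x y z w)"
      if "x \<in> grade A a" "y \<in> grade B (d - a)" "y' \<in> grade B (d - a)" "z \<in> grade A' b" "w \<in> grade B' (e - b)" for b c x y y' z w
      using lin(1)[OF that(4,5), of a] that unfolding bilinear_on_def linear_on_def by auto
    note cl = fs.subspace_add[OF sub(1)] fs.subspace_add[OF sub(2)] fs.subspace_scale[OF sub(1)] fs.subspace_scale[OF sub(2)]
    show ?thesis
      unfolding bilinear_on_def linear_on_def
    proof (intro conjI ballI allI)
      fix x y y' c assume h: "x \<in> grade A a" "y \<in> grade B (d - a)" "y' \<in> grade B (d - a)"
      show "g a x (y + y') t = g a x y t + g a x y' t"
        by (rule eq[where f = "g a x (y + y')" and h = "\<lambda>t. g a x y t + g a x y' t"])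
           (use h cl in \<open>auto intro!: g_lin linear_on_add_scl simp: g_pten b'\<close>)
    next
      fix x y c assume h: "x \<in> grade A a" "y \<in> grade B (d - a)"
      show "g a x (scl c y) t = scl c (g a x y t)"
        by (rule eq[where f = "g a x (scl c y)" and h = "\<lambda>t. scl c (g a x y t)"])
           (use h cl in \<open>auto intro!: g_lin linear_on_add_scl simp: g_pten b'\<close>)
      show "g a (scl c x) y t = scl c (g a x y t)"
        by (rule eq[where f = "g a (scl c x) y" and h = "\<lambda>t. scl c (g a x y t)"])
           (use h cl in \<open>auto intro!: g_lin linear_on_add_scl simp: g_pten b\<close>)
    next
      fix x x' y assume h: "y \<in> grade B (d - a)" "x \<in> grade A a" "x' \<in> grade A a"
      show "g a (x + x') y t = g a x y t + g a x' y t"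
        by (rule eq[where f = "g a (x + x') y" and h = "\<lambda>t. g a x y t + g a x' y t"])
           (use h cl in \<open>auto intro!: g_lin linear_on_add_scl simp: g_pten b\<close>)
    qed
  qed
  define f where "f s t = tensor_lift A B d (\<lambda>a x y. g a x y t) s" for s t
  have f_lin: "linear_on (tensor_gr A B d) (\<lambda>s. f s t)"
    and f_pten: "\<And>a x y. x \<in> grade A a \<Longrightarrow> y \<in> grade B (d - a) \<Longrightarrow> f (pten a x y) t = g a x y t"
    if "t \<in> tensor_gr A' B' e" for t
    using tensor_lift_universal[OF sub(1,2), of d "\<lambda>a x y. g a x y t", OF g_bil[OF that]] by (simp_all add: f_def)
  have f_lin2: "linear_on (tensor_gr A' B' e) (f s)" if s: "s \<in> tensor_gr A B d" for s
  proof -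
    have eq: "p s = q s" if "linear_on (tensor_gr A B d) p" "linear_on (tensor_gr A B d) q"
      "\<And>a x y. x \<in> grade A a \<Longrightarrow> y \<in> grade B (d - a) \<Longrightarrow> p (pten a x y) = q (pten a x y)" for p q :: "(int \<times> 'i \<times> 'j \<Rightarrow> 'k) \<Rightarrow> ('l \<Rightarrow> 'k)"
      using linear_on_span_eq[of _ p q s] that s unfolding tensor_gr_def by blast
    have cl: "t + t' \<in> tensor_gr A' B' e" "scl c t \<in> tensor_gr A' B' e"
      if "t \<in> tensor_gr A' B' e" "t' \<in> tensor_gr A' B' e" for t t' c
      using that fs.span_add fs.span_scale unfolding tensor_gr_def by blast+
    show ?thesis
      unfolding linear_on_def
    proof (intro conjI ballI allI)
      fix t t' assume t: "t \<in> tensor_gr A' B' e" "t' \<in> tensor_gr A' B' e"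
      show "f s (t + t') = f s t + f s t'"
        by (rule eq[where p = "\<lambda>s. f s (t + t')" and q = "\<lambda>s. f s t + f s t'"])
           (use t cl in \<open>auto intro!: f_lin linear_on_add_scl simp: f_pten linear_onD[OF g_lin]\<close>)
    next
      fix t c assume t: "t \<in> tensor_gr A' B' e"
      show "f s (scl c t) = scl c (f s t)"
        by (rule eq[where p = "\<lambda>s. f s (scl c t)" and q = "\<lambda>s. scl c (f s t)"])
           (use t cl in \<open>auto intro!: f_lin linear_on_add_scl simp: f_pten linear_onD[OF g_lin]\<close>)
    qed
  qed
  have "pten b z w \<in> tensor_gr A' B' e" if "z \<in> grade A' b" "w \<in> grade B' (e - b)" for b z w
    unfolding tensor_gr_def by (rule fs.span_base) (use that in blast)
  then have "f (pten a x y) (pten b z w) = \<beta> a b x y z w"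
    if "x \<in> grade A a" "y \<in> grade B (d - a)" "z \<in> grade A' b" "w \<in> grade B' (e - b)" for a b x y z w
    using that by (simp add: f_pten g_pten)
  moreover have "bilinear_on (tensor_gr A B d) (tensor_gr A' B' e) f"
    using f_lin f_lin2 by (auto simp: bilinear_on_def)
  ultimately show ?thesis by blast
qed


section \<open>Operadic suspension\<close>

text \<open>
  Each tensor product enlarges the index type.  To iterate the suspension within one type, an operad
  on the index type \<^typ>\<open>'i\<close> is transported to the index type \<^typ>\<open>'j\<close> along an injection \<open>\<iota>\<close>:
  functions on \<^typ>\<open>'i\<close> are identified with the functions on \<^typ>\<open>'j\<close> supported on the range of \<open>\<iota>\<close>.
\<close>

definition push :: "('i \<Rightarrow> 'j) \<Rightarrow> ('i \<Rightarrow> 'k::field) \<Rightarrow> ('j \<Rightarrow> 'k)" where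
  "push \<iota> x = (\<lambda>j. if j \<in> range \<iota> then x (inv \<iota> j) else 0)"

definition pull :: "('i \<Rightarrow> 'j) \<Rightarrow> ('j \<Rightarrow> 'k) \<Rightarrow> ('i \<Rightarrow> 'k)" where
  "pull \<iota> x = (\<lambda>i. x (\<iota> i))"

lemma pull_push: "inj \<iota> \<Longrightarrow> pull \<iota> (push \<iota> x) = x"
  by (simp add: pull_def push_def)

definition reindex :: "('i \<Rightarrow> 'j) \<Rightarrow> ('k::field, 'i) dgop \<Rightarrow> ('k, 'j) dgop" where
  "reindex \<iota> P = \<lparr>
    op_ar = (\<lambda>n. \<lparr>grade = (\<lambda>d. push \<iota> ` op_gr P n d), bdry = (\<lambda>d x. push \<iota> (op_bd P n d (pull \<iota> x)))\<rparr>),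
    op_act = (\<lambda>n \<sigma> d x. push \<iota> (op_act P n \<sigma> d (pull \<iota> x))),
    op_comp = (\<lambda>m n i d e x y. push \<iota> (op_comp P m n i d e (pull \<iota> x) (pull \<iota> y))),
    op_unit = push \<iota> (op_unit P)\<rparr>"

definition reindex_map :: "('i \<Rightarrow> 'i') \<Rightarrow> ('j \<Rightarrow> 'j') \<Rightarrow> ('k::field, 'i, 'j) opmap \<Rightarrow> ('k, 'i', 'j') opmap" where
  "reindex_map \<iota> \<kappa> \<phi> n d x = push \<kappa> (\<phi> n d (pull \<iota> x))"

text \<open>
  Suspended operads have index type \<open>'k sidx\<close>: the indices of an \<open>r\<close>-fold suspension
  \<open>(\<dots>(P \<otimes> End) \<otimes> \<dots>) \<otimes> End\<close>, \<open>End\<close> the endomorphism operad of \<open>k[1]\<close>, are collected in a list.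
\<close>

type_synonym 'k sidx = "(int \<times> int \<times> ((int \<times> unit) list \<Rightarrow> 'k) \<times> unit) list"

definition sidx_cons :: "int \<times> 'k sidx \<times> (int \<times> ((int \<times> unit) list \<Rightarrow> 'k) \<times> unit) \<Rightarrow> 'k sidx" where
  "sidx_cons = (\<lambda>(a, is, h). (a, h) # is)"

lemma inj_sidx_cons: "inj sidx_cons"
  by (auto simp: inj_def sidx_cons_def)

definition susp :: "('k::field, 'k sidx) dgop \<Rightarrow> ('k, 'k sidx) dgop" where
  "susp P = reindex sidx_cons (tensor_op P (end_op (conc 1)))"

definition susp_map :: "('k::field, 'k sidx) dgop
    \<Rightarrow> ('k, 'k sidx, 'k sidx) opmap \<Rightarrow> ('k, 'k sidx, 'k sidx) opmap" where
  "susp_map P \<phi> = reindex_map sidx_cons sidx_cons (tensor_map P (end_op (conc 1)) \<phi> (\<lambda>n d x. x))"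


section \<open>The stable commutativity operad\<close>

definition comm_susp :: "nat \<Rightarrow> ('k::field, 'k sidx) dgop" where
  "comm_susp r = (susp ^^ r) (reindex (\<lambda>u. []) comm_op)"

text \<open>
  In arity one, both the suspension of the commutativity operad and the commutativity operad itself
  are \<open>k[0]\<close>, with basis the operadic unit.
\<close>

definition stabilization :: "('k::field, 'k sidx, 'k sidx) opmap" where
  "stabilization n d x = (if n = 1 \<and> d = 0
    then scl (THE c. x = scl c (op_unit (comm_susp 1))) (op_unit (comm_susp 0)) else 0)"

primrec stab_map :: "nat \<Rightarrow> ('k::field, 'k sidx, 'k sidx) opmap" where
  "stab_map 0 = stabilization"
| "stab_map (Suc r) = susp_map (comm_susp (Suc r)) (stab_map r)"

text \<open>
  The limit of a tower of operads \<open>S r\<close> and maps \<open>\<psi> r : S (Suc r) \<rightarrow> S r\<close> consists of the compatible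
  sequences; the element \<open>x\<close> encodes the sequence with terms \<open>term_at x r\<close>.
\<close>

definition term_at :: "(nat \<times> 'i \<Rightarrow> 'k) \<Rightarrow> nat \<Rightarrow> ('i \<Rightarrow> 'k)" where
  "term_at x r = (\<lambda>i. x (r, i))"

definition seq :: "(nat \<Rightarrow> 'i \<Rightarrow> 'k) \<Rightarrow> (nat \<times> 'i \<Rightarrow> 'k)" where
  "seq f = (\<lambda>(r, i). f r i)"

definition lim_op :: "(nat \<Rightarrow> ('k::field, 'i) dgop) \<Rightarrow> (nat \<Rightarrow> ('k, 'i, 'i) opmap)
    \<Rightarrow> ('k, nat \<times> 'i) dgop" where
  "lim_op S \<psi> = \<lparr>
    op_ar = (\<lambda>n. \<lparr>
      grade = (\<lambda>d. {x. \<forall>r. term_at x r \<in> op_gr (S r) n d \<and>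
        \<psi> r n d (term_at x (Suc r)) = term_at x r}),
      bdry = (\<lambda>d x. seq (\<lambda>r. op_bd (S r) n d (term_at x r)))\<rparr>),
    op_act = (\<lambda>n \<sigma> d x. seq (\<lambda>r. op_act (S r) n \<sigma> d (term_at x r))),
    op_comp = (\<lambda>m n i d e x y. seq (\<lambda>r. op_comp (S r) m n i d e (term_at x r) (term_at y r))),
    op_unit = seq (\<lambda>r. op_unit (S r))\<rparr>"

definition comm_st :: "('k::field, nat \<times> 'k sidx) dgop" where
  "comm_st = lim_op comm_susp stab_map"

end

theory Submission
  imports Defs
begin

text \<open>
  Every map of the tower vanishes outside arity one and preserves units, and in arity one each
  \<open>\<Sigma>\<^sup>r Comm\<close> is the line spanned by its unit.  A compatible sequence is therefore zero outside arity
  one and a fixed multiple of the sequence of units in arity one, and an operad which is nothing but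
  the line spanned by its unit is determined up to isomorphism.
\<close>

section \<open>Operads concentrated on the span of the unit\<close>

text \<open>The operations of tensor products and of endomorphism operads are picked by
  \<open>SOME\<close> and \<open>THE\<close>, so nothing is known about them until maps with the
  prescribed values have been exhibited. Their operad axioms involve Koszul signs in all arities,
  and the proof does not establish them for the suspensions. The axioms are verified for the limit,
  where each of them has a zero argument or speaks of multiples of the unit in arity one and degree
  zero, so that every sign is 1. The line in arity one survives suspension because
  \<open>End\<close> of k[1] in arity n is a line in degree 1 - n: in arity one the suspension
  tensors with k[0]. The differential of the limit vanishes, which makes the argument uniform in the
  degree \<open>s\<close> and yields the chain and the cochain statement together.\<close>

text \<open>The block of n inputs starting at i goes onto the block starting at
  \<open>\<sigma> i\<close>; the other inputs move as under \<open>\<sigma>\<close> once the block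
  is collapsed to one input, and are then spread out around the image block. The equivariance axiom
  acts by \<open>perm_comp\<close>, and the action is controlled for permutations only.\<close>

lemma perm_comp_permutes:
  assumes i: "i < m" and \<sigma>: "\<sigma> permutes {..<m}" and \<tau>: "\<tau> permutes {..<n}"
  shows "perm_comp m n i \<sigma> \<tau> permutes {..<m + n - 1}"
proof -
  \<comment> \<open>\<open>J\<close> collapses the source block and \<open>sh\<close> makes room for
    the image block. Natural subtraction does not truncate, even for n = 0: \<open>sh\<close> is
    applied only to \<open>a \<noteq> \<sigma> i\<close>, so its second branch has a >= 1, and the
    second branch of \<open>J\<close> is applied only for p >= i + n.\<close>
  define sh where "sh a = (if a < \<sigma> i then a else a + n - 1)" for a
  define J where "J p = (if p < i then p else p + 1 - n)" for p
  have \<sigma>_lt: "\<sigma> a < m" if "a < m" for a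
    using permutes_in_image[OF \<sigma>, of a] that by simp
  have \<tau>_lt: "\<tau> a < n" if "a < n" for a
    using permutes_in_image[OF \<tau>, of a] that by simp
  have sh_lt: "sh a < m + n - 1" if "a < m" "a \<noteq> \<sigma> i" for a
    using that \<sigma>_lt[OF i] by (auto simp: sh_def)
  have sh_out: "sh a < \<sigma> i \<or> sh a \<ge> \<sigma> i + n" if "a \<noteq> \<sigma> i" for a
    using that by (auto simp: sh_def)
  have sh_inj: "a = b" if "sh a = sh b" "a \<noteq> \<sigma> i" "b \<noteq> \<sigma> i" for a b
    using that by (auto simp: sh_def split: if_splits)
  have \<sigma>_inj: "a = b" if "\<sigma> a = \<sigma> b" for a b
    using permutes_inj[OF \<sigma>] that by (simp add: inj_eq)
  have \<tau>_inj: "a = b" if "\<tau> a = \<tau> b" for a b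
    using permutes_inj[OF \<tau>] that by (simp add: inj_eq)
  have J: "J p < m" "J p \<noteq> i" "\<sigma> (J p) \<noteq> \<sigma> i" if "p < m + n - 1" "p < i \<or> p \<ge> i + n" for p
  proof -
    show "J p < m" "J p \<noteq> i" using that i by (auto simp: J_def)
    then show "\<sigma> (J p) \<noteq> \<sigma> i" using \<sigma>_inj by blast
  qed
  have outer: "perm_comp m n i \<sigma> \<tau> p = sh (\<sigma> (J p))" if "p < m + n - 1" "p < i \<or> p \<ge> i + n" for p
    using that by (auto simp: perm_comp_def J_def sh_def Let_def)
  have inner: "perm_comp m n i \<sigma> \<tau> p = \<sigma> i + \<tau> (p - i)" if "i \<le> p" "p < i + n" for p
    using that by (auto simp: perm_comp_def Let_def)
  have fixed: "perm_comp m n i \<sigma> \<tau> p = p" if "p \<ge> m + n - 1" for p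
    using that i by (auto simp: perm_comp_def Let_def)
  have maps: "perm_comp m n i \<sigma> \<tau> p < m + n - 1" if p: "p < m + n - 1" for p
  proof (cases "p < i \<or> p \<ge> i + n")
    case True
    then show ?thesis using outer J sh_lt \<sigma>_lt p by simp
  next
    case False
    then have "\<tau> (p - i) < n" using \<tau>_lt by auto
    then show ?thesis using False inner[of p] \<sigma>_lt[OF i] by simp
  qed
  have inj: "inj_on (perm_comp m n i \<sigma> \<tau>) {..<m + n - 1}"
  proof (rule inj_onI)
    fix p q assume "p \<in> {..<m + n - 1}" "q \<in> {..<m + n - 1}"
      and eq: "perm_comp m n i \<sigma> \<tau> p = perm_comp m n i \<sigma> \<tau> q"
    then have p: "p < m + n - 1" and q: "q < m + n - 1" by auto
    show "p = q"
    proof (cases "p < i \<or> p \<ge> i + n"; cases "q < i \<or> q \<ge> i + n")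
      assume pq: "p < i \<or> p \<ge> i + n" "q < i \<or> q \<ge> i + n"
      then have "J p = J q" using eq outer p q J sh_inj \<sigma>_inj by metis
      with pq show ?thesis by (auto simp: J_def split: if_splits)
    next
      assume pq: "p < i \<or> p \<ge> i + n" "\<not> (q < i \<or> q \<ge> i + n)"
      then have "\<tau> (q - i) < n" using \<tau>_lt by auto
      then show ?thesis
        using pq eq outer[OF p] inner[of q] sh_out[OF J(3)[OF p pq(1)]] by auto
    next
      assume pq: "\<not> (p < i \<or> p \<ge> i + n)" "q < i \<or> q \<ge> i + n"
      then have "\<tau> (p - i) < n" using \<tau>_lt by auto
      then show ?thesis
        using pq eq outer[OF q] inner[of p] sh_out[OF J(3)[OF q pq(2)]] by auto
    next
      assume pq: "\<not> (p < i \<or> p \<ge> i + n)" "\<not> (q < i \<or> q \<ge> i + n)"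
      then show ?thesis using eq inner[of p] inner[of q] \<tau>_inj[of "p - i" "q - i"] by auto
    qed
  qed
  have "bij_betw (perm_comp m n i \<sigma> \<tau>) {..<m + n - 1} {..<m + n - 1}"
    unfolding bij_betw_def
    by (intro conjI inj endo_inj_surj) (use maps inj in auto)
  then show ?thesis by (rule bij_imp_permutes) (use fixed in auto)
qed

text \<open>The conditions do not mention the degree of the differential, so they describe chain and
  cochain operads alike. Bilinearity of the composition is a consequence: all elements are zero or
  multiples of the unit.\<close>

locale constant_like =
  fixes P :: "('k::field, 'i) dgop"
  assumes gr: "op_gr P n d = (if n = 1 \<and> d = 0 then range (\<lambda>c. scl c (op_unit P)) else {0})"
    and unit_nonzero: "op_unit P \<noteq> 0"
    and bd: "x \<in> op_gr P n d \<Longrightarrow> op_bd P n d x = 0"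
    and act: "\<sigma> permutes {..<n} \<Longrightarrow> x \<in> op_gr P n d \<Longrightarrow> op_act P n \<sigma> d x = x"
    and comp_zero: "i < m \<Longrightarrow> x \<in> op_gr P m d \<Longrightarrow> op_comp P m n i d e x 0 = 0"
      "i < m \<Longrightarrow> y \<in> op_gr P n e \<Longrightarrow> op_comp P m n i d e 0 y = 0"
    and comp_unit: "op_comp P 1 1 0 0 0 (scl a (op_unit P)) (scl b (op_unit P)) = scl (a * b) (op_unit P)"
begin

lemma zero_in_gr: "0 \<in> op_gr P n d"
  by (auto simp: gr scl_def fun_eq_iff intro!: exI[of _ 0])

lemma gr_cases:
  assumes "x \<in> op_gr P n d"
  obtains "x = 0" | c where "n = 1" "d = 0" "x = scl c (op_unit P)"
  using assms by (auto simp: gr split: if_splits)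

lemma scl_unit_in_gr: "scl c (op_unit P) \<in> op_gr P 1 0"
  by (auto simp: gr)

lemma subspace_gr: "fs.subspace (op_gr P n d)"
  unfolding fs.subspace_def
proof (intro conjI ballI allI zero_in_gr)
  fix x y c assume x: "x \<in> op_gr P n d"
  show "scl c x \<in> op_gr P n d"
    using x by (auto simp: gr split: if_splits)
  assume y: "y \<in> op_gr P n d"
  show "x + y \<in> op_gr P n d"
    using x y by (auto simp: gr simp flip: fs.scale_left_distrib split: if_splits)
qed

lemma comp_closed:
  assumes i: "i < m" and x: "x \<in> op_gr P m d" and y: "y \<in> op_gr P n e"
  shows "op_comp P m n i d e x y \<in> op_gr P (m + n - 1) (d + e)"
proof (cases rule: gr_cases[OF x])
  case 1
  then show ?thesis using comp_zero(2)[OF i y] zero_in_gr by simp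
next
  case (2 c)
  note x' = this
  show ?thesis
  proof (cases rule: gr_cases[OF y])
    case 1
    then show ?thesis using comp_zero(1)[OF i x] zero_in_gr by simp
  next
    case (2 c')
    then have "op_comp P m n i d e x y = scl (c * c') (op_unit P)"
      using comp_unit x' i by simp
    then show ?thesis using scl_unit_in_gr x' 2 by simp
  qed
qed

lemma comp_bilinear:
  assumes i: "i < m"
  shows "bilinear_on (op_gr P m d) (op_gr P n e) (op_comp P m n i d e)"
proof (cases "m = 1 \<and> n = 1 \<and> d = 0 \<and> e = 0")
  case True
  then show ?thesis using i
    by (auto simp: bilinear_on_def linear_on_def gr comp_unit[unfolded One_nat_def] algebra_simps
      simp flip: fs.scale_left_distrib)
next
  case False
  then have "op_comp P m n i d e x y = 0" if "x \<in> op_gr P m d" "y \<in> op_gr P n e" for x y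
    using that comp_zero[OF i] by (metis gr_cases)
  then show ?thesis
    using fs.subspace_add[OF subspace_gr] fs.subspace_scale[OF subspace_gr]
    by (auto simp: bilinear_on_def linear_on_def)
qed

text \<open>In each axiom either some argument is zero, and both sides vanish, or all arguments are
  multiples of the unit, and the axiom becomes an identity in the field.\<close>

lemma operad: "dg_operad s P"
proof unfold_locales
  show "fs.subspace (op_gr P n d)" for n d by (rule subspace_gr)
  show "x \<in> op_gr P n d \<Longrightarrow> op_bd P n d x \<in> op_gr P n (d + s)" for n d x
    by (simp add: bd zero_in_gr)
  show "linear_on (op_gr P n d) (op_bd P n d)" for n d
    using fs.subspace_add[OF subspace_gr] fs.subspace_scale[OF subspace_gr]
    by (auto simp: linear_on_def bd)
  show "x \<in> op_gr P n d \<Longrightarrow> op_bd P n (d + s) (op_bd P n d x) = 0" for n d x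
    by (simp add: bd zero_in_gr)
  show "\<sigma> permutes {..<n} \<Longrightarrow> x \<in> op_gr P n d \<Longrightarrow> op_act P n \<sigma> d x \<in> op_gr P n d" for \<sigma> n x d
    by (simp add: act)
  show "\<sigma> permutes {..<n} \<Longrightarrow> linear_on (op_gr P n d) (op_act P n \<sigma> d)" for \<sigma> n d
    using fs.subspace_add[OF subspace_gr] fs.subspace_scale[OF subspace_gr]
    by (auto simp: linear_on_def act)
  show "\<sigma> permutes {..<n} \<Longrightarrow> x \<in> op_gr P n d \<Longrightarrow>
      op_act P n \<sigma> (d + s) (op_bd P n d x) = op_bd P n d (op_act P n \<sigma> d x)" for \<sigma> n d x
    by (simp add: act bd zero_in_gr)
  show "x \<in> op_gr P n d \<Longrightarrow> op_act P n id d x = x" for n d x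
    by (rule act) (auto simp: permutes_id)
  show "\<sigma> permutes {..<n} \<Longrightarrow> \<tau> permutes {..<n} \<Longrightarrow> x \<in> op_gr P n d \<Longrightarrow>
      op_act P n \<tau> d (op_act P n \<sigma> d x) = op_act P n (\<sigma> \<circ> \<tau>) d x" for \<sigma> \<tau> n d x
    by (simp add: act permutes_compose)
  show "i < m \<Longrightarrow> x \<in> op_gr P m d \<Longrightarrow> y \<in> op_gr P n e \<Longrightarrow>
      op_comp P m n i d e x y \<in> op_gr P (m + n - 1) (d + e)" for i m n d e x y
    by (rule comp_closed)
  show "i < m \<Longrightarrow> bilinear_on (op_gr P m d) (op_gr P n e) (op_comp P m n i d e)" for i m n d e
    by (rule comp_bilinear)
  show "i < m \<Longrightarrow> x \<in> op_gr P m d \<Longrightarrow> y \<in> op_gr P n e \<Longrightarrow>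
      op_bd P (m + n - 1) (d + e) (op_comp P m n i d e x y) =
      op_comp P m n i (d + s) e (op_bd P m d x) y +
      scl ((-1) powi d) (op_comp P m n i d (e + s) x (op_bd P n e y))" for i m n d e x y
    using bd[OF comp_closed] by (simp add: bd comp_zero)
  show "op_unit P \<in> op_gr P 1 0" using scl_unit_in_gr[of 1] by simp
  then show "op_bd P 1 0 (op_unit P) = 0" by (rule bd)
  have unit: "op_unit P \<in> op_gr P 1 0" by fact
  show "op_comp P 1 n 0 0 d (op_unit P) x = x" if x: "x \<in> op_gr P n d" for n d x
  proof (cases rule: gr_cases[OF x])
    case 1
    then show ?thesis using comp_zero(1)[OF _ unit, of 0] by simp
  next
    case (2 c)
    then show ?thesis using comp_unit[of 1 c] by simp
  qed
  show "op_comp P n 1 i d 0 x (op_unit P) = x" if i: "i < n" and x: "x \<in> op_gr P n d" for n d x i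
  proof (cases rule: gr_cases[OF x])
    case 1
    then show ?thesis using comp_zero(2)[OF i unit] by simp
  next
    case (2 c)
    then show ?thesis using i comp_unit[of c 1] by simp
  qed
  show "op_comp P (l + m - 1) n (i + j) (d + e) f (op_comp P l m i d e x y) z =
      op_comp P l (m + n - 1) i d (e + f) x (op_comp P m n j e f y z)"
    if i: "i < l" "j < m" and x: "x \<in> op_gr P l d" and y: "y \<in> op_gr P m e" and z: "z \<in> op_gr P n f"
    for i l j m n d e f x y z
  proof -
    have ij: "i + j < l + m - 1" using i by simp
    note c = comp_closed[OF i(1) x y] comp_closed[OF i(2) y z]
    consider "x = 0 \<or> y = 0 \<or> z = 0"
      | a b c where "x = scl a (op_unit P)" "y = scl b (op_unit P)" "z = scl c (op_unit P)"
        "l = 1" "m = 1" "n = 1" "d = 0" "e = 0" "f = 0"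
      using x y z by (meson gr_cases)
    then show ?thesis
    proof cases
      case 1
      then show ?thesis using i ij c x y z by (auto simp: comp_zero)
    next
      case 2
      then show ?thesis using i by (simp add: comp_unit[unfolded One_nat_def] mult.assoc)
    qed
  qed
  show "op_comp P (l + m - 1) n (j + m - 1) (d + e) f (op_comp P l m i d e x y) z =
      scl ((-1) powi (e * f))
        (op_comp P (l + n - 1) m i (d + f) e (op_comp P l n j d f x z) y)"
    if i: "i < j" "j < l" and x: "x \<in> op_gr P l d" and y: "y \<in> op_gr P m e" and z: "z \<in> op_gr P n f"
    for i l j m n d e f x y z
  proof -
    \<comment> \<open>Two different inputs force arity at least 2, where only zero lives; the Koszul
      sign multiplies zero.\<close>
    have "x = 0" using i x by (auto simp: gr)
    moreover have "j + m - 1 < l + m - 1" "i < l + n - 1" "i < l" using i by auto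
    ultimately show ?thesis using i y z by (simp add: comp_zero)
  qed
  show "op_comp P m n i d e (op_act P m \<sigma> d x) (op_act P n \<tau> e y) =
      op_act P (m + n - 1) (perm_comp m n i \<sigma> \<tau>) (d + e) (op_comp P m n (\<sigma> i) d e x y)"
    if i: "i < m" and p: "\<sigma> permutes {..<m}" "\<tau> permutes {..<n}"
      and x: "x \<in> op_gr P m d" and y: "y \<in> op_gr P n e" for i m n \<sigma> \<tau> d e x y
  proof -
    have \<sigma>i: "\<sigma> i < m" using permutes_in_image[OF p(1), of i] i by simp
    \<comment> \<open>A nonzero x has arity one, so i and \<open>\<sigma> i\<close> are both 0. The
      permutations on the two sides act trivially.\<close>
    have "op_comp P m n i d e x y = op_comp P m n (\<sigma> i) d e x y"
    proof (cases rule: gr_cases[OF x])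
      case 1
      then show ?thesis using comp_zero(2)[OF i y] comp_zero(2)[OF \<sigma>i y] by simp
    next
      case 2
      then show ?thesis using i \<sigma>i by simp
    qed
    then show ?thesis
      using act[OF perm_comp_permutes[OF i p] comp_closed[OF \<sigma>i x y]] act p x y by simp
  qed
qed

text \<open>Negating degrees fixes degree zero, the only one that carries a nonzero element.\<close>

lemma dagger: "constant_like (op_dagger P)"
proof unfold_locales
  show "op_comp (op_dagger P) 1 1 0 0 0 (scl a (op_unit (op_dagger P))) (scl b (op_unit (op_dagger P))) =
      scl (a * b) (op_unit (op_dagger P))" for a b
    using comp_unit[of a b] by (simp add: op_dagger_def)
qed (auto simp: op_dagger_def dagger_def gr bd act comp_zero unit_nonzero split: if_splits)

end

section \<open>Uniqueness up to isomorphism\<close>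

text \<open>The isomorphism matches the units and extends linearly; both operads multiply
  coefficients in the same way.\<close>

lemma constant_like_iso:
  fixes P :: "('k::field, 'i) dgop" and Q :: "('k, 'j) dgop"
  assumes "constant_like P" "constant_like Q"
  shows "dg_operad_iso s P Q"
proof -
  interpret P: constant_like P by fact
  interpret Q: constant_like Q by fact
  \<comment> \<open>A coordinate at which the unit does not vanish reads off the coefficient: if x
    is c times the unit, then c is \<open>x j / op_unit P j\<close>. This formula is linear in x and
    sends 0 to 0 in every arity and degree.\<close>
  obtain j where j: "op_unit P j \<noteq> 0" using P.unit_nonzero by (auto simp: fun_eq_iff)
  define \<phi> :: "('k, 'i, 'j) opmap" where "\<phi> n d x = scl (x j / op_unit P j) (op_unit Q)" for n d x
  have \<phi>_unit: "\<phi> n d (scl c (op_unit P)) = scl c (op_unit Q)" for n d c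
    using j by (simp add: \<phi>_def scl_def)
  have \<phi>_0: "\<phi> n d 0 = 0" for n d
    by (simp add: \<phi>_def)
  have closed: "\<phi> n d x \<in> op_gr Q n d" if "x \<in> op_gr P n d" for n d x
    using that by (rule P.gr_cases) (auto simp: \<phi>_0 \<phi>_unit Q.zero_in_gr Q.scl_unit_in_gr simp del: One_nat_def)
  have "dg_operad_hom s P Q \<phi>"
  proof
    show "x \<in> op_gr P n d \<Longrightarrow> \<phi> n d x \<in> op_gr Q n d" for n d x by (rule closed)
    show "linear_on (op_gr P n d) (\<phi> n d)" for n d
      by (auto simp: linear_on_def \<phi>_def scl_def fun_eq_iff algebra_simps add_divide_distrib)
    show "x \<in> op_gr P n d \<Longrightarrow> \<phi> n (d + s) (op_bd P n d x) = op_bd Q n d (\<phi> n d x)" for n d x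
      using closed by (simp add: P.bd Q.bd \<phi>_0)
    show "\<sigma> permutes {..<n} \<Longrightarrow> x \<in> op_gr P n d \<Longrightarrow>
      \<phi> n d (op_act P n \<sigma> d x) = op_act Q n \<sigma> d (\<phi> n d x)" for \<sigma> n d x
      using closed by (simp add: P.act Q.act)
    show "\<phi> (m + n - 1) (d + e) (op_comp P m n i d e x y) = op_comp Q m n i d e (\<phi> m d x) (\<phi> n e y)"
      if i: "i < m" and x: "x \<in> op_gr P m d" and y: "y \<in> op_gr P n e" for i m n d e x y
    proof (cases "x = 0 \<or> y = 0")
      case True
      then show ?thesis
        using closed[OF x] closed[OF y] i x y by (auto simp: P.comp_zero Q.comp_zero \<phi>_0)
    next
      case False
      then obtain a b where "x = scl a (op_unit P)" "y = scl b (op_unit P)" "m = 1" "n = 1" "d = 0" "e = 0"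
        using x y by (meson P.gr_cases)
      then show ?thesis
        using i by (simp add: \<phi>_unit P.comp_unit[unfolded One_nat_def] Q.comp_unit[unfolded One_nat_def])
    qed
    show "\<phi> 1 0 (op_unit P) = op_unit Q" using \<phi>_unit[of _ _ 1] by simp
  qed
  moreover have "bij_betw (\<phi> n d) (op_gr P n d) (op_gr Q n d)" for n d
  proof (cases "n = 1 \<and> d = 0")
    case True
    have "inj_on (\<phi> n d) (range (\<lambda>c. scl c (op_unit P)))"
      using Q.unit_nonzero by (auto simp: inj_on_def \<phi>_unit fs.scale_cancel_right)
    moreover have "\<phi> n d ` range (\<lambda>c. scl c (op_unit P)) = range (\<lambda>c. scl c (op_unit Q))"
      by (auto simp: image_image \<phi>_unit)
    ultimately show ?thesis using True by (simp add: bij_betw_def P.gr Q.gr)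
  next
    case False
    then show ?thesis by (auto simp: bij_betw_def P.gr Q.gr \<phi>_0)
  qed
  ultimately show ?thesis
    unfolding dg_operad_iso_def using P.operad Q.operad by blast
qed

lemma constant_like_const_op: "constant_like (const_op :: ('k::field, unit) dgop)"
proof
  have "x = scl (x ()) (\<lambda>_. 1)" for x :: "unit \<Rightarrow> 'k"
    by (simp add: scl_def fun_eq_iff)
  then have "range (\<lambda>c. scl c (\<lambda>_. 1)) = (UNIV :: (unit \<Rightarrow> 'k) set)"
    by (rule surjI[OF sym])
  then show "op_gr (const_op :: ('k, unit) dgop) n d =
      (if n = 1 \<and> d = 0 then range (\<lambda>c. scl c (op_unit const_op)) else {0})" for n d
    by (simp add: const_op_def conc_def zero_cpx_def)
  show "op_unit const_op \<noteq> (0 :: unit \<Rightarrow> 'k)"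
    by (simp add: const_op_def fun_eq_iff)
  show "op_bd const_op n d x = (0 :: unit \<Rightarrow> 'k)" for n d x
    by (simp add: const_op_def conc_def zero_cpx_def zero_fun_def)
  show "op_act const_op n \<sigma> d x = x" for n \<sigma> d and x :: "unit \<Rightarrow> 'k"
    by (simp add: const_op_def)
  show "op_comp const_op m n i d e x 0 = 0" "op_comp const_op m n i d e 0 x = 0"
    for m n i d e and x :: "unit \<Rightarrow> 'k"
    by (simp_all add: const_op_def zero_fun_def)
  show "op_comp const_op 1 1 0 0 0 (scl a (op_unit const_op)) (scl b (op_unit const_op)) =
      (scl (a * b) (op_unit const_op) :: unit \<Rightarrow> 'k)" for a b
    by (simp add: const_op_def scl_def)
qed


section \<open>Multilinear operations with a line in arity one\<close>

text \<open>
  The part of the operad structure that has to be carried along the suspensions: linearity makes the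
  maps chosen by \<open>SOME\<close> in the tensor products exist, and in the limit only arity one survives.
\<close>

locale unit_line =
  fixes P :: "('k::field, 'i) dgop"
  assumes subspace_gr: "fs.subspace (op_gr P n d)"
    and bd_linear: "linear_on (op_gr P n d) (op_bd P n d)"
    and act_linear: "\<sigma> permutes {..<n} \<Longrightarrow> linear_on (op_gr P n d) (op_act P n \<sigma> d)"
    and comp_bilinear: "i < m \<Longrightarrow> bilinear_on (op_gr P m d) (op_gr P n e) (op_comp P m n i d e)"
    and gr_one: "op_gr P 1 d = (if d = 0 then range (\<lambda>c. scl c (op_unit P)) else {0})"
    and unit_nonzero: "op_unit P \<noteq> 0"
    and bd_unit: "op_bd P 1 0 (op_unit P) = 0"
    and act_unit: "op_act P 1 id 0 (op_unit P) = op_unit P"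
    and comp_unit: "op_comp P 1 1 0 0 0 (op_unit P) (op_unit P) = op_unit P"
begin

lemma zero_in_gr: "0 \<in> op_gr P n d"
  by (rule fs.subspace_0[OF subspace_gr])

lemma unit_in_gr: "op_unit P \<in> op_gr P 1 0"
  unfolding gr_one by (auto intro!: image_eqI[of _ _ 1])

lemma bd_zero: "op_bd P n d 0 = 0"
  by (rule linear_on_zero[OF bd_linear zero_in_gr])

lemma act_zero: "\<sigma> permutes {..<n} \<Longrightarrow> op_act P n \<sigma> d 0 = 0"
  by (rule linear_on_zero[OF act_linear zero_in_gr])

lemma comp_zero:
  "i < m \<Longrightarrow> x \<in> op_gr P m d \<Longrightarrow> op_comp P m n i d e x 0 = 0"
  "i < m \<Longrightarrow> y \<in> op_gr P n e \<Longrightarrow> op_comp P m n i d e 0 y = 0"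
  using comp_bilinear[of i m d n e] linear_on_zero zero_in_gr unfolding bilinear_on_def
  by (blast, metis (mono_tags, lifting))

end

lemma unit_line_comm_op: "unit_line (comm_op :: ('k::field, unit) dgop)"
proof -
  interpret dg_operad "-1" "comm_op :: ('k, unit) dgop" by (rule comm_op)
  show ?thesis
  proof unfold_locales
    show "fs.subspace (op_gr (comm_op :: ('k, unit) dgop) n d)" for n d
      using ar_complex by (rule dg_complex.subspace_grade)
    show "linear_on (op_gr (comm_op :: ('k, unit) dgop) n d) (op_bd comm_op n d)" for n d
      using ar_complex by (rule dg_complex.bdry_linear)
  qed (use act_linear comp_bilinear in
    \<open>auto simp: comm_op_def conc_def scl_def fun_eq_iff image_iff\<close>)
qed

section \<open>Transport along an injection of index types\<close>

lemma push_add: "push \<iota> (x + y) = push \<iota> x + push \<iota> y"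
  and push_scl: "push \<iota> (scl c x) = scl c (push \<iota> x)"
  and push_zero: "push \<iota> 0 = 0"
  by (auto simp: push_def scl_def fun_eq_iff)

lemma push_eq_iff: "inj \<iota> \<Longrightarrow> push \<iota> x = push \<iota> y \<longleftrightarrow> x = y"
  by (metis pull_push)

lemma linear_on_push:
  assumes "inj \<iota>" "linear_on V f"
  shows "linear_on (push \<iota> ` V) (\<lambda>x. push \<kappa> (f (pull \<iota> x)))"
  unfolding linear_on_def
proof (intro conjI ballI allI)
  fix x y c assume "x \<in> push \<iota> ` V"
  then obtain x' where x: "x = push \<iota> x'" "x' \<in> V" by auto
  show "push \<kappa> (f (pull \<iota> (scl c x))) = scl c (push \<kappa> (f (pull \<iota> x)))"
    unfolding x(1) push_scl[symmetric] pull_push[OF assms(1)] linear_onD(2)[OF assms(2) x(2)] ..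
  assume "y \<in> push \<iota> ` V"
  then obtain y' where y: "y = push \<iota> y'" "y' \<in> V" by auto
  show "push \<kappa> (f (pull \<iota> (x + y))) = push \<kappa> (f (pull \<iota> x)) + push \<kappa> (f (pull \<iota> y))"
    unfolding x(1) y(1) push_add[symmetric] pull_push[OF assms(1)] linear_onD(1)[OF assms(2) x(2) y(2)] ..
qed

lemma unit_line_reindex:
  fixes P :: "('k::field, 'i) dgop" and \<iota> :: "'i \<Rightarrow> 'j"
  assumes "unit_line P" and \<iota>: "inj \<iota>"
  shows "unit_line (reindex \<iota> P)"
proof -
  interpret unit_line P by fact
  show ?thesis
  proof unfold_locales
    fix n m :: nat and d e :: int and i :: nat and \<sigma> :: "nat \<Rightarrow> nat"
    show "fs.subspace (op_gr (reindex \<iota> P) n d)"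
    proof -
      have "0 \<in> push \<iota> ` op_gr P n d"
        using zero_in_gr push_zero by (metis image_eqI)
      moreover have "push \<iota> x + push \<iota> y \<in> push \<iota> ` op_gr P n d" "scl c (push \<iota> x) \<in> push \<iota> ` op_gr P n d"
        if "x \<in> op_gr P n d" "y \<in> op_gr P n d" for x y c
        unfolding push_add[symmetric] push_scl[symmetric]
        using that fs.subspace_add[OF subspace_gr] fs.subspace_scale[OF subspace_gr] by blast+
      ultimately show ?thesis
        unfolding fs.subspace_def reindex_def by auto
    qed
    show "linear_on (op_gr (reindex \<iota> P) n d) (op_bd (reindex \<iota> P) n d)"
      using linear_on_push[OF \<iota> bd_linear] by (simp add: reindex_def)
    show "linear_on (op_gr (reindex \<iota> P) n d) (op_act (reindex \<iota> P) n \<sigma> d)" if "\<sigma> permutes {..<n}"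
      using linear_on_push[OF \<iota> act_linear[OF that]] by (simp add: reindex_def)
    show "bilinear_on (op_gr (reindex \<iota> P) m d) (op_gr (reindex \<iota> P) n e) (op_comp (reindex \<iota> P) m n i d e)"
      if "i < m"
      unfolding bilinear_on_def
    proof (intro conjI ballI)
      fix x assume "x \<in> op_gr (reindex \<iota> P) m d"
      then have "pull \<iota> x \<in> op_gr P m d" using \<iota> by (auto simp: reindex_def pull_push)
      then have "linear_on (op_gr P n e) (op_comp P m n i d e (pull \<iota> x))"
        using comp_bilinear[OF that] by (simp add: bilinear_on_def)
      from linear_on_push[OF \<iota> this]
      show "linear_on (op_gr (reindex \<iota> P) n e) (op_comp (reindex \<iota> P) m n i d e x)"
        by (simp add: reindex_def)
    next
      fix y assume "y \<in> op_gr (reindex \<iota> P) n e"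
      then have "pull \<iota> y \<in> op_gr P n e" using \<iota> by (auto simp: reindex_def pull_push)
      then have "linear_on (op_gr P m d) (\<lambda>x. op_comp P m n i d e x (pull \<iota> y))"
        using comp_bilinear[OF that] by (simp add: bilinear_on_def)
      from linear_on_push[OF \<iota> this]
      show "linear_on (op_gr (reindex \<iota> P) m d) (\<lambda>x. op_comp (reindex \<iota> P) m n i d e x y)"
        by (simp add: reindex_def)
    qed
    show "op_gr (reindex \<iota> P) 1 d = (if d = 0 then range (\<lambda>c. scl c (op_unit (reindex \<iota> P))) else {0})"
      unfolding reindex_def using gr_one[of d] by (simp add: push_zero push_scl image_image)
    show "op_unit (reindex \<iota> P) \<noteq> 0"
      using unit_nonzero push_eq_iff[OF \<iota>, of "op_unit P" 0] by (simp add: reindex_def push_zero)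
    show "op_bd (reindex \<iota> P) 1 0 (op_unit (reindex \<iota> P)) = 0"
      using bd_unit \<iota> by (simp add: reindex_def pull_push push_zero)
    show "op_act (reindex \<iota> P) 1 id 0 (op_unit (reindex \<iota> P)) = op_unit (reindex \<iota> P)"
      using act_unit \<iota> by (simp add: reindex_def pull_push)
    show "op_comp (reindex \<iota> P) 1 1 0 0 0 (op_unit (reindex \<iota> P)) (op_unit (reindex \<iota> P)) = op_unit (reindex \<iota> P)"
      using comp_unit \<iota> by (simp add: reindex_def pull_push)
  qed
qed


subsection \<open>Tensor products\<close>

lemma bilinear_on_pten:
  assumes "linear_on V f" "linear_on W g"
  shows "bilinear_on V W (\<lambda>x y. pten a (f x) (g y))"
  using assms by (auto simp: bilinear_on_def linear_on_def pten_add1 pten_add2 pten_scl1 pten_scl2)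

lemma bilinear_on_add:
  assumes "bilinear_on V W f" "bilinear_on V W g"
  shows "bilinear_on V W (\<lambda>x y. f x y + g x y)"
  using assms unfolding bilinear_on_def by (auto intro: linear_on_add_scl)

lemma bilinear_on_scl:
  assumes "bilinear_on V W f"
  shows "bilinear_on V W (\<lambda>x y. scl c (f x y))"
  using assms unfolding bilinear_on_def by (auto intro: linear_on_add_scl)

lemma linear_on_ident: "linear_on V (\<lambda>x. x)"
  by (simp add: linear_on_def)

lemma linear_on_const_zero: "linear_on V (\<lambda>x. 0)"
  by (simp add: linear_on_def)

lemma pten_in_tensor_gr: "x \<in> grade A a \<Longrightarrow> y \<in> grade B (d - a) \<Longrightarrow> pten a x y \<in> tensor_gr A B d"
  unfolding tensor_gr_def by (rule fs.span_base) blast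

text \<open>The universal property shows that the chosen operations exist, hence are linear and have
  the prescribed values on pure tensors. In arity one the only nonzero summand is the product of two
  lines in degree zero, spanned by the tensor product of the units.\<close>

lemma unit_line_tensor_op:
  fixes P :: "('k::field, 'i) dgop" and Q :: "('k, 'j) dgop"
  assumes "unit_line P" "unit_line Q"
  shows "unit_line (tensor_op P Q)"
proof -
  interpret P: unit_line P by fact
  interpret Q: unit_line Q by fact
  note lift = tensor_lift_universal[OF P.subspace_gr Q.subspace_gr]
  let ?T = "tensor_op P Q"
  have gr: "op_gr ?T n = tensor_gr (op_ar P n) (op_ar Q n)" for n
    by (simp add: tensor_op_def tensor_cpx_def)
  have unit_in: "pten 0 (op_unit P) (op_unit Q) \<in> op_gr ?T 1 0"
    unfolding gr using P.unit_in_gr Q.unit_in_gr by (intro pten_in_tensor_gr) auto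
  have unit: "op_unit ?T = pten 0 (op_unit P) (op_unit Q)"
    by (simp add: tensor_op_def)
  have bd_bil: "bilinear_on (op_gr P n a) (op_gr Q n (d - a)) (\<lambda>x y.
      pten (a - 1) (op_bd P n a x) y + scl ((-1) powi a) (pten a x (op_bd Q n (d - a) y)))" for n a d
    by (intro bilinear_on_add bilinear_on_scl bilinear_on_pten linear_on_ident P.bd_linear Q.bd_linear)
  have bd: "op_bd ?T n d = tensor_lift (op_ar P n) (op_ar Q n) d (\<lambda>a x y.
      pten (a - 1) (op_bd P n a x) y + scl ((-1) powi a) (pten a x (op_bd Q n (d - a) y)))" for n d
    by (simp add: tensor_op_def tensor_cpx_def)
  have act_bil: "bilinear_on (op_gr P n a) (op_gr Q n (d - a)) (\<lambda>x y.
      pten a (op_act P n \<sigma> a x) (op_act Q n \<sigma> (d - a) y))" if "\<sigma> permutes {..<n}" for n a d \<sigma>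
    using that by (intro bilinear_on_pten P.act_linear Q.act_linear)
  have act: "op_act ?T n \<sigma> d = tensor_lift (op_ar P n) (op_ar Q n) d (\<lambda>a x y.
      pten a (op_act P n \<sigma> a x) (op_act Q n \<sigma> (d - a) y))" for n \<sigma> d
    by (simp add: tensor_op_def)
  \<comment> \<open>The composition is a \<open>SOME\<close> over bilinear maps; extending the
    formula on pure tensors in both arguments supplies a witness, so the chosen map has these
    properties too.\<close>
  have "\<exists>f. bilinear_on (op_gr ?T m d) (op_gr ?T n e) f \<and>
      (\<forall>a b. \<forall>x \<in> op_gr P m a. \<forall>y \<in> op_gr Q m (d - a). \<forall>z \<in> op_gr P n b. \<forall>w \<in> op_gr Q n (e - b).
        f (pten a x y) (pten b z w) = scl ((-1) powi ((d - a) * b))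
          (pten (a + b) (op_comp P m n i a b x z) (op_comp Q m n i (d - a) (e - b) y w)))"
    if "i < m" for m n i d e
    unfolding gr using P.comp_bilinear[OF that] Q.comp_bilinear[OF that]
    by (intro tensor_lift2 P.subspace_gr Q.subspace_gr bilinear_on_scl bilinear_on_pten)
       (auto simp: bilinear_on_def)
  from someI_ex[OF this]
  have comp_bil: "bilinear_on (op_gr ?T m d) (op_gr ?T n e) (op_comp ?T m n i d e)"
    and comp_pten: "x \<in> op_gr P m a \<Longrightarrow> y \<in> op_gr Q m (d - a) \<Longrightarrow> z \<in> op_gr P n b \<Longrightarrow> w \<in> op_gr Q n (e - b) \<Longrightarrow>
        op_comp ?T m n i d e (pten a x y) (pten b z w) = scl ((-1) powi ((d - a) * b))
          (pten (a + b) (op_comp P m n i a b x z) (op_comp Q m n i (d - a) (e - b) y w))"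
    if "i < m" for m n i d e a b x y z w
    using that unfolding gr by (simp_all add: tensor_op_def)
  show ?thesis
  proof unfold_locales
    fix n m :: nat and d e :: int and i :: nat and \<sigma> :: "nat \<Rightarrow> nat"
    show "fs.subspace (op_gr ?T n d)"
      unfolding gr tensor_gr_def by (rule fs.subspace_span)
    show "linear_on (op_gr ?T n d) (op_bd ?T n d)"
      unfolding gr bd by (rule lift(1)[OF bd_bil])
    show "linear_on (op_gr ?T n d) (op_act ?T n \<sigma> d)" if "\<sigma> permutes {..<n}"
      unfolding gr act by (rule lift(1)[OF act_bil[OF that]])
    show "bilinear_on (op_gr ?T m d) (op_gr ?T n e) (op_comp ?T m n i d e)" if "i < m"
      by (rule comp_bil[OF that])
    show "op_gr ?T 1 d = (if d = 0 then range (\<lambda>c. scl c (op_unit ?T)) else {0})"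
    proof (cases "d = 0")
      case True
      have "op_gr ?T 1 0 \<subseteq> range (\<lambda>c. scl c (op_unit ?T))"
        unfolding gr tensor_gr_def
      proof (rule fs.span_minimal)
        show "fs.subspace (range (\<lambda>c. scl c (op_unit ?T)))"
          by (auto simp: fs.subspace_def image_iff simp flip: fs.scale_left_distrib)
        show "{pten a x y |a x y. x \<in> op_gr P 1 a \<and> y \<in> op_gr Q 1 (0 - a)} \<subseteq> range (\<lambda>c. scl c (op_unit ?T))"
        proof safe
          fix a x y assume xy: "x \<in> op_gr P 1 a" "y \<in> op_gr Q 1 (0 - a)"
          show "pten a x y \<in> range (\<lambda>c. scl c (op_unit ?T))"
          proof (cases "a = 0")
            case True
            then obtain b c where "x = scl b (op_unit P)" "y = scl c (op_unit Q)"
              using xy unfolding P.gr_one Q.gr_one by auto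
            then show ?thesis using True by (auto simp: unit pten_scl1 pten_scl2)
          next
            case False
            then have "pten a x y = scl 0 (op_unit ?T)" using xy unfolding P.gr_one by simp
            then show ?thesis by blast
          qed
        qed
      qed
      moreover have "range (\<lambda>c. scl c (op_unit ?T)) \<subseteq> op_gr ?T 1 0"
        using unit_in fs.span_scale unfolding unit gr tensor_gr_def by blast
      ultimately show ?thesis using True by simp
    next
      case False
      \<comment> \<open>For nonzero d, at least one of a and d - a is nonzero, so one tensor factor
        is zero.\<close>
      have "{pten a x y |a x y. x \<in> op_gr P 1 a \<and> y \<in> op_gr Q 1 (d - a)} \<subseteq> {0}"
        using False unfolding P.gr_one Q.gr_one by (auto split: if_splits)
      then have "op_gr ?T 1 d \<subseteq> {0}"
        unfolding gr tensor_gr_def by (rule fs.span_minimal) (rule fs.subspace_single_0)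
      moreover have "0 \<in> op_gr ?T 1 d"
        unfolding gr tensor_gr_def by (rule fs.span_zero)
      ultimately show ?thesis using False by auto
    qed
    obtain p q where "op_unit P p \<noteq> 0" "op_unit Q q \<noteq> 0"
      using P.unit_nonzero Q.unit_nonzero by (auto simp: fun_eq_iff)
    then have "op_unit ?T (0, p, q) \<noteq> 0" by (simp add: unit pten_def)
    then show "op_unit ?T \<noteq> 0" by (metis zero_fun_apply)
    have PQ: "op_unit P \<in> op_gr P 1 0" "op_unit Q \<in> op_gr Q 1 (0 - 0)"
      using P.unit_in_gr Q.unit_in_gr by simp_all
    show "op_bd ?T 1 0 (op_unit ?T) = 0"
      unfolding bd unit lift(2)[OF bd_bil PQ] using P.bd_unit Q.bd_unit by simp
    show "op_act ?T 1 id 0 (op_unit ?T) = op_unit ?T"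
      unfolding act unit lift(2)[OF act_bil[OF permutes_id] PQ] using P.act_unit Q.act_unit by simp
    show "op_comp ?T 1 1 0 0 0 (op_unit ?T) (op_unit ?T) = op_unit ?T"
      unfolding unit comp_pten[OF zero_less_one PQ PQ] using P.comp_unit Q.comp_unit by simp
  qed
qed


section \<open>The endomorphism operad of a shifted line\<close>

text \<open>An element of k[1] in a degree other than 1 is zero, and such an entry kills both the
  product of coordinates and the pure tensor. With all degrees 1, the constant index list is the
  only one that matches.\<close>

lemma hom_lists_conc_one:
  assumes "xs \<in> hom_lists (conc 1) n d"
  shows "ptens xs is = (if is = replicate n (1, ()) then prod_list (map (\<lambda>(a, x). x ()) xs) else 0)"
    and "prod_list (map (\<lambda>(a, x). x ()) xs) \<noteq> 0 \<Longrightarrow> fst ` set xs \<subseteq> {1}"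
proof -
  have "length xs = n" "\<forall>(a, x)\<in>set xs. x \<in> grade (conc 1) a"
    using assms by (auto simp: hom_lists_def)
  then have "ptens xs is = (if is = replicate n (1, ()) then prod_list (map (\<lambda>(a, x). x ()) xs) else 0)
    \<and> (prod_list (map (\<lambda>(a, x). x ()) xs) \<noteq> 0 \<longrightarrow> fst ` set xs \<subseteq> {1})"
  proof (induction xs arbitrary: n "is")
    case Nil
    then show ?case by (cases "is") auto
  next
    case (Cons p xs)
    obtain a x where p: "p = (a, x)" by force
    show ?case
    proof (cases "is")
      case Nil
      then show ?thesis using Cons.prems Cons.IH[of "length xs" "is"] p by (auto simp: conc_def split: if_splits)
    next
      case (Cons q js)
      then show ?thesis
        using Cons.prems Cons.IH[of "length xs" js] p by (cases q) (auto simp: conc_def split: if_splits)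
    qed
  qed
  then show "ptens xs is = (if is = replicate n (1, ()) then prod_list (map (\<lambda>(a, x). x ()) xs) else 0)"
    "prod_list (map (\<lambda>(a, x). x ()) xs) \<noteq> 0 \<Longrightarrow> fst ` set xs \<subseteq> {1}" by blast+
qed

text \<open>The coefficient of the pure tensor of \<open>xs\<close> with respect to the generator of
  the tensor power of k[1], which is the pure tensor of \<open>ones n\<close>.\<close>

definition cprod :: "(int \<times> (unit \<Rightarrow> 'k::field)) list \<Rightarrow> 'k" where
  "cprod xs = prod_list (map (\<lambda>(a, x). x ()) xs)"

definition ones :: "nat \<Rightarrow> (int \<times> (unit \<Rightarrow> 'k::field)) list" where
  "ones n = replicate n (1, \<lambda>_. 1)"

lemma cprod_append: "cprod (xs @ ys) = cprod xs * cprod ys"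
  and cprod_Cons: "cprod ((a, x) # xs) = x () * cprod xs"
  by (simp_all add: cprod_def)

lemma cprod_ones: "cprod (ones n) = 1"
  by (simp add: cprod_def ones_def)

lemma degsum_const_one: "fst ` set xs \<subseteq> {1} \<Longrightarrow> degsum xs = int (length xs)"
  by (induction xs) (auto simp: degsum_def)

lemma ones_in_hom_lists: "ones n \<in> hom_lists (conc 1) n (int n)"
proof -
  have "degsum (ones n) = int n"
    by (subst degsum_const_one) (auto simp: ones_def)
  then show ?thesis by (auto simp: hom_lists_def ones_def conc_def)
qed

text \<open>Used in both directions: total degree other than n makes the coefficient vanish, and a
  nonvanishing coefficient makes all degrees 1, which fixes every Koszul sign.\<close>

lemma cprod_nonzero:
  assumes "xs \<in> hom_lists (conc 1) n d" "cprod xs \<noteq> 0"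
  shows "fst ` set xs \<subseteq> {1}" "d = int n" "length xs = n"
proof -
  show *: "fst ` set xs \<subseteq> {1}" using hom_lists_conc_one(2)[OF assms(1)] assms(2) by (simp add: cprod_def)
  show "length xs = n" using assms by (simp add: hom_lists_def)
  then show "d = int n" using degsum_const_one[OF *] assms by (simp add: hom_lists_def)
qed

lemma ptens_ones: "ptens (ones n) js = (if js = replicate n (1, ()) then 1 else 0)"
  by (simp add: hom_lists_conc_one(1)[OF ones_in_hom_lists] cprod_ones[unfolded cprod_def])

lemma ptens_eq_scl_ones:
  assumes "xs \<in> hom_lists (conc 1) n d"
  shows "ptens xs = scl (cprod xs) (ptens (ones n))"
proof
  fix js
  show "ptens xs js = scl (cprod xs) (ptens (ones n)) js"
    using hom_lists_conc_one(1)[OF assms, of js] by (simp add: scl_def cprod_def ptens_ones)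
qed

lemma grade_tpow: "grade (tpow X n) d = fs.span (ptens ` hom_lists X n d)"
  by (simp add: tpow_def Let_def)

lemma ptens_in_tpow: "xs \<in> hom_lists X n d \<Longrightarrow> ptens xs \<in> grade (tpow X n) d"
  unfolding grade_tpow by (intro fs.span_base) blast

lemma grade_conc: "grade (conc a) d = (if d = a then UNIV else {0})"
  by (simp add: conc_def)

lemma bdry_conc: "bdry (conc a) d x = 0"
  by (simp add: conc_def zero_fun_def)

text \<open>The differential of a tensor power is chosen by \<open>SOME\<close>, so even its value
  at 0 rests on the existence of a linear map with the required values. As k[1] has zero
  differential, the zero map is one.\<close>

lemma bdry_tpow_conc_zero: "bdry (tpow (conc 1 :: ('k::field, unit) cpx) n) d 0 = 0"
proof -
  let ?X = "conc 1 :: ('k, unit) cpx"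
  let ?V = "fs.span (ptens ` hom_lists ?X n d)"
  \<comment> \<open>A zero entry kills a pure tensor whatever degree label it carries; here the
    label is the shifted one, a - 1.\<close>
  have 0: "ptens (xs[j := (b, 0 :: unit \<Rightarrow> 'k)]) = 0" if "j < length xs" for xs :: "(int \<times> (unit \<Rightarrow> 'k)) list" and j b
  proof
    fix js show "ptens (xs[j := (b, 0)]) js = (0 :: (int \<times> unit) list \<Rightarrow> 'k) js"
      using that
    proof (induction xs arbitrary: j js)
      case (Cons p xs)
      then show ?case by (cases p; cases js; cases j) auto
    qed simp
  qed
  have "\<exists>D. linear_on ?V D \<and> (\<forall>xs \<in> hom_lists ?X n d. D (ptens xs) =
      (\<Sum>j<n. case xs ! j of (a, x) \<Rightarrow>
        scl ((-1) powi degsum (take j xs)) (ptens (xs[j := (a - 1, bdry ?X a x)]))))"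
  proof (intro exI[of _ "\<lambda>_. 0"] conjI ballI linear_on_const_zero)
    fix xs assume xs: "xs \<in> hom_lists ?X n d"
    have "(case xs ! j of (a, x) \<Rightarrow>
        scl ((-1) powi degsum (take j xs)) (ptens (xs[j := (a - 1, bdry ?X a x)]))) = 0" if "j < n" for j
      using xs that by (simp add: bdry_conc hom_lists_def 0 split: prod.splits)
    then show "0 = (\<Sum>j<n. case xs ! j of (a, x) \<Rightarrow>
        scl ((-1) powi degsum (take j xs)) (ptens (xs[j := (a - 1, bdry ?X a x)])))"
      by simp
  qed
  from someI_ex[OF this] have "linear_on ?V (bdry (tpow ?X n) d)"
    by (simp add: tpow_def Let_def)
  then show ?thesis by (rule linear_on_zero) (rule fs.span_zero)
qed

section \<open>Homomorphisms from a tensor power of k[1] to k[1]\<close>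

text \<open>The map \<open>k[1]\<^sup>\<otimes>\<^sup>n \<rightarrow> k[1]\<close> which sends the generator to \<open>c\<close> times the generator.\<close>

definition line_map :: "nat \<Rightarrow> 'k::field \<Rightarrow> (int \<times> ((int \<times> unit) list \<Rightarrow> 'k) \<times> unit \<Rightarrow> 'k)" where
  "line_map n c = (\<lambda>(a, x, j).
    if a = int n \<and> x \<in> grade (tpow (conc 1) n) a then c * x (replicate n (1, ())) else 0)"

lemma line_map_add: "line_map n (c + c') = line_map n c + line_map n c'"
  and line_map_scl: "line_map n (c * c') = scl c (line_map n c')"
  and line_map_0: "line_map n 0 = 0"
  by (auto simp: line_map_def scl_def fun_eq_iff algebra_simps)

text \<open>\<open>D\<close> stands for the degree condition d = 1 - n. As it does not involve c,
  the set of coefficients is the whole field or 0, which treats all degrees at once.\<close>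

lemma subspace_line_map: "fs.subspace (line_map n ` {c. D \<or> c = (0 :: 'k::field)})"
  unfolding fs.subspace_def
proof (intro conjI ballI allI)
  show "0 \<in> line_map n ` {c. D \<or> c = (0 :: 'k)}"
    by (rule image_eqI[of _ _ 0]) (simp_all add: line_map_0)
  fix x y a assume x: "x \<in> line_map n ` {c. D \<or> c = (0 :: 'k)}"
  then show "scl a x \<in> line_map n ` {c. D \<or> c = 0}"
    unfolding image_iff by (metis (mono_tags, lifting) line_map_scl mem_Collect_eq mult_zero_right)
  assume "y \<in> line_map n ` {c. D \<or> c = (0 :: 'k)}"
  then show "x + y \<in> line_map n ` {c. D \<or> c = 0}"
    using x unfolding image_iff by (metis (mono_tags, lifting) line_map_add mem_Collect_eq add_0)
qed

text \<open>The action, and the composition with one argument held fixed, multiply the coefficient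
  by a fixed scalar k; this turns such formulas into linearity.\<close>

lemma linear_on_line_map:
  assumes f: "\<And>c :: 'k::field. D \<or> c = 0 \<Longrightarrow> f (line_map n c) = line_map m (k * c)"
  shows "linear_on (line_map n ` {c. D \<or> c = 0}) f"
  unfolding linear_on_def
proof (intro conjI ballI allI)
  fix x y a assume "x \<in> line_map n ` {c. D \<or> c = (0 :: 'k)}"
  then obtain b where b: "x = line_map n b" "D \<or> b = 0" by auto
  then have "D \<or> a * b = 0" by auto
  from f[OF this] show "f (scl a x) = scl a (f x)"
    unfolding b(1) f[OF b(2)] line_map_scl[symmetric] by (simp add: mult.left_commute)
  assume "y \<in> line_map n ` {c. D \<or> c = (0 :: 'k)}"
  then obtain c where c: "y = line_map n c" "D \<or> c = 0" by auto
  then have "D \<or> b + c = 0" using b by auto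
  from f[OF this] show "f (x + y) = f x + f y"
    unfolding b(1) c(1) f[OF b(2)] f[OF c(2)] line_map_add[symmetric] by (simp add: distrib_left)
qed

lemma hap_line_map:
  assumes xs: "xs \<in> hom_lists (conc 1) n a"
  shows "hap (line_map n c) a (ptens xs) = (\<lambda>_. c * cprod xs)"
proof (cases "a = int n")
  case True
  then show ?thesis using ptens_in_tpow[OF xs] hom_lists_conc_one(1)[OF xs]
    by (auto simp: hap_def line_map_def cprod_def)
next
  case False
  then have "cprod xs = 0" using cprod_nonzero[OF xs] by auto
  then show ?thesis using False by (auto simp: hap_def line_map_def)
qed

lemma line_map_inject: "line_map n c = line_map n c' \<longleftrightarrow> c = c'"
  using hap_line_map[OF ones_in_hom_lists, of n c] hap_line_map[OF ones_in_hom_lists, of n c']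
  by (auto simp: cprod_ones dest: fun_cong)

lemma linear_on_hap_line_map: "linear_on (grade (tpow (conc 1) n) a) (hap (line_map n (c :: 'k::field)) a)"
proof -
  let ?V = "grade (tpow (conc 1 :: ('k, unit) cpx) n) a"
  have eq: "hap (line_map n c) a x = (\<lambda>_. if a = int n then c * x (replicate n (1, ())) else 0)" if "x \<in> ?V" for x
    using that by (auto simp: hap_def line_map_def)
  have sub: "fs.subspace ?V" unfolding grade_tpow by (rule fs.subspace_span)
  show ?thesis
    unfolding linear_on_def
  proof (intro conjI ballI allI)
    fix x y b assume x: "x \<in> ?V"
    show "hap (line_map n c) a (scl b x) = scl b (hap (line_map n c) a x)"
      unfolding eq[OF x] eq[OF fs.subspace_scale[OF sub x]] by (auto simp: scl_def)
    assume y: "y \<in> ?V"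
    show "hap (line_map n c) a (x + y) = hap (line_map n c) a x + hap (line_map n c) a y"
      unfolding eq[OF x] eq[OF y] eq[OF fs.subspace_add[OF sub x y]] by (auto simp: distrib_left)
  qed
qed

text \<open>The n-th tensor power of k[1] is a line in degree n and the target a line in degree 1,
  so a homogeneous map is determined by one coefficient and can be nonzero in degree 1 - n
  only.\<close>

lemma grade_end_conc:
  "grade (hom_cpx (tpow (conc 1) n) (conc 1 :: ('k::field, unit) cpx)) d = line_map n ` {c. d = 1 - int n \<or> c = 0}"
  (is "grade ?E d = _")
proof (intro equalityI subsetI)
  fix F assume F: "F \<in> grade ?E d"
  let ?A = "tpow (conc 1 :: ('k, unit) cpx) n"
  have lin: "linear_on (grade ?A a) (hap F a)"
    and into: "x \<in> grade ?A a \<Longrightarrow> hap F a x \<in> grade (conc 1) (a + d)"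
    and out: "x \<notin> grade ?A a \<Longrightarrow> hap F a x = 0" for a x
    using F by (auto simp: hom_cpx_def)
  \<comment> \<open>The image of the generator has degree n + d in k[1], hence vanishes unless this
    is 1.\<close>
  define c where "c = hap F (int n) (ptens (ones n)) ()"
  have c: "d = 1 - int n \<or> c = 0"
    using into[OF ptens_in_tpow[OF ones_in_hom_lists]] by (auto simp: c_def conc_def split: if_splits)
  have gen: "hap F a (ptens xs) = hap (line_map n c) a (ptens xs)" if xs: "xs \<in> hom_lists (conc 1) n a" for a xs
  proof (cases "a = int n")
    case True
    have "hap F a (ptens xs) = scl (cprod xs) (hap F a (ptens (ones n)))"
      unfolding ptens_eq_scl_ones[OF xs]
      using linear_onD(2)[OF lin ptens_in_tpow[OF ones_in_hom_lists]] True by simp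
    then show ?thesis
      unfolding hap_line_map[OF xs] by (simp add: c_def True scl_def mult.commute)
  next
    case False
    then have "cprod xs = 0" using cprod_nonzero[OF xs] by auto
    moreover from this have "ptens xs = 0" using ptens_eq_scl_ones[OF xs] by simp
    moreover have "hap F a 0 = 0" by (rule linear_on_zero[OF lin]) (simp add: grade_tpow fs.span_zero)
    ultimately show ?thesis unfolding hap_line_map[OF xs] by (simp add: zero_fun_def)
  qed
  have "hap F a x = hap (line_map n c) a x" for a x
  proof (cases "x \<in> grade ?A a")
    case True
    show ?thesis
      by (rule linear_on_span_eq[OF lin[unfolded grade_tpow] linear_on_hap_line_map[unfolded grade_tpow] _
            True[unfolded grade_tpow]])
        (use gen in auto)
  next
    case False
    \<comment> \<open>Both sides are extended by zero outside the graded piece; this convention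
      makes the equality one of functions.\<close>
    then show ?thesis using out[OF False] by (auto simp: hap_def line_map_def fun_eq_iff)
  qed
  then have "F = line_map n c" by (auto simp: hap_def fun_eq_iff)
  then show "F \<in> line_map n ` {c. d = 1 - int n \<or> c = 0}" using c by blast
next
  fix F assume "F \<in> line_map n ` {c. d = 1 - int n \<or> c = (0 :: 'k)}"
  then obtain c where c: "d = 1 - int n \<or> c = 0" and F: "F = line_map n c" by auto
  have "hap F a x \<in> grade (conc 1) (a + d)" "x \<notin> grade (tpow (conc 1) n) a \<Longrightarrow> hap F a x = 0" for a x
    using c unfolding F by (auto simp: hap_def line_map_def fun_eq_iff grade_conc)
  then show "F \<in> grade ?E d"
    using linear_on_hap_line_map[of n _ c] by (simp add: hom_cpx_def F)
qed

text \<open>Evaluates the descriptions by \<open>THE\<close> in \<open>end_op\<close>: with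
  \<open>T\<close> the prescribed values on pure tensors, \<open>line_map n h\<close> satisfies
  them, and the value at the generator determines the coefficient.\<close>

lemma the_line_map:
  assumes h: "d = 1 - int n \<or> h = 0"
    and T: "\<And>a xs. xs \<in> hom_lists (conc 1) n a \<Longrightarrow> T a xs = (\<lambda>_. h * cprod xs)"
  shows "(THE G. G \<in> grade (hom_cpx (tpow (conc 1) n) (conc 1 :: ('k::field, unit) cpx)) d \<and>
    (\<forall>a. \<forall>xs \<in> hom_lists (conc 1) n a. hap G a (ptens xs) = T a xs)) = line_map n h"
proof (rule the_equality)
  show "line_map n h \<in> grade (hom_cpx (tpow (conc 1) n) (conc 1 :: ('k::field, unit) cpx)) d \<and>
    (\<forall>a. \<forall>xs \<in> hom_lists (conc 1) n a. hap (line_map n h) a (ptens xs) = T a xs)"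
    using h T by (auto simp: grade_end_conc hap_line_map)
next
  fix G assume G: "G \<in> grade (hom_cpx (tpow (conc 1) n) (conc 1 :: ('k::field, unit) cpx)) d \<and>
    (\<forall>a. \<forall>xs \<in> hom_lists (conc 1) n a. hap G a (ptens xs) = T a xs)"
  then obtain c where c: "G = line_map n c" by (auto simp: grade_end_conc)
  have "hap G (int n) (ptens (ones n)) = T (int n) (ones n)" using G ones_in_hom_lists by blast
  then have "c = h"
    using T[OF ones_in_hom_lists] hap_line_map[OF ones_in_hom_lists, of n c]
    by (auto simp: c cprod_ones dest: fun_cong)
  then show "G = line_map n h" using c by simp
qed

section \<open>The operad structure of End in terms of coefficients\<close>

text \<open>With all entries in degree 1 every inversion contributes the same factor -1, so the sign
  depends on \<open>\<sigma>\<close> alone.\<close>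

lemma koszul_const_one:
  assumes "length xs = n" "fst ` set xs \<subseteq> {1}"
  shows "koszul \<sigma> xs = (koszul \<sigma> (ones n :: (int \<times> (unit \<Rightarrow> 'k)) list) :: 'k::field)"
proof -
  have "fst (xs ! p) = 1" if "p < n" for p using assms that nth_mem by fastforce
  then show ?thesis
    unfolding koszul_def using assms(1)
    by (intro prod.cong) (auto simp: ones_def)
qed

text \<open>The permuted list has the same multiset of entries, and both the total degree and the
  coefficient depend on the multiset only.\<close>

lemma map_permute_hom_lists:
  fixes xs :: "(int \<times> (unit \<Rightarrow> 'k::field)) list"
  assumes \<sigma>: "\<sigma> permutes {..<n}" and xs: "xs \<in> hom_lists (conc 1) n a"
  defines "ys \<equiv> map (\<lambda>q. xs ! inv \<sigma> q) [0..<n]"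
  shows "ys \<in> hom_lists (conc 1) n a" "cprod ys = cprod xs"
proof -
  have len: "length xs = n" using xs by (simp add: hom_lists_def)
  have "image_mset (inv \<sigma>) (mset_set {..<n}) = mset_set {..<n}"
    by (subst image_mset_mset_set) (use permutes_inv[OF \<sigma>] in \<open>auto simp: permutes_image permutes_inj_on\<close>)
  moreover have "mset ys = image_mset ((!) xs) (image_mset (inv \<sigma>) (mset_set {..<n}))"
    by (simp add: ys_def lessThan_atLeast0 multiset.map_comp comp_def)
  ultimately have "mset ys = image_mset ((!) xs) (mset_set {..<n})" by simp
  also have "\<dots> = mset xs" unfolding len[symmetric]
    by (metis lessThan_atLeast0 map_nth mset_map mset_upt)
  finally have ms: "mset ys = mset xs" .
  then have "set ys = set xs" "length ys = length xs"
    by (rule mset_eq_setD, rule mset_eq_length)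
  moreover have "degsum ys = degsum xs"
    unfolding degsum_def by (metis ms mset_map sum_mset_sum_list)
  ultimately show "ys \<in> hom_lists (conc 1) n a" using xs by (simp add: hom_lists_def)
  show "cprod ys = cprod xs"
    unfolding cprod_def by (metis ms mset_map prod_mset_prod_list)
qed

lemma end_op_act_line_map:
  assumes \<sigma>: "\<sigma> permutes {..<n}" and d: "d = 1 - int n \<or> c = 0"
  shows "op_act (end_op (conc 1)) n \<sigma> d (line_map n c) = line_map n (koszul \<sigma> (ones n :: (int \<times> (unit \<Rightarrow> 'k)) list) * (c :: 'k::field))"
proof -
  have "scl (koszul \<sigma> xs) (hap (line_map n c) a (ptens (map (\<lambda>q. xs ! inv \<sigma> q) [0..<n]))) =
      (\<lambda>_. koszul \<sigma> (ones n :: (int \<times> (unit \<Rightarrow> 'k)) list) * c * cprod xs)"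
    if xs: "xs \<in> hom_lists (conc 1) n a" for a and xs :: "(int \<times> (unit \<Rightarrow> 'k)) list"
  \<comment> \<open>If the coefficient vanishes, the degrees of the entries and thus the sign are
    unknown, but both sides are zero; otherwise all degrees are 1 and the sign is the one of
    \<open>ones n\<close>.\<close>
  proof (cases "cprod xs = 0")
    case False
    then show ?thesis
      using hap_line_map[OF map_permute_hom_lists(1)[OF \<sigma> xs], of c] map_permute_hom_lists(2)[OF \<sigma> xs]
        koszul_const_one[OF cprod_nonzero(3,1)[OF xs False], of \<sigma>] by (simp add: scl_def mult.assoc)
  qed (use hap_line_map[OF map_permute_hom_lists(1)[OF \<sigma> xs], of c] map_permute_hom_lists(2)[OF \<sigma> xs] in \<open>simp add: scl_def\<close>)
  then show ?thesis
    unfolding end_op_def Let_def dgop.simps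
    by (intro the_line_map) (use d in auto)
qed

lemma hom_lists_append:
  assumes "xs \<in> hom_lists X m a" "ys \<in> hom_lists X n b"
  shows "xs @ ys \<in> hom_lists X (m + n) (a + b)"
  using assms by (auto simp: hom_lists_def degsum_def)

lemma hom_lists_take_drop:
  assumes "xs \<in> hom_lists X n a" "i \<le> n"
  shows "take i xs \<in> hom_lists X i (degsum (take i xs))" "drop i xs \<in> hom_lists X (n - i) (degsum (drop i xs))"
  using assms by (auto simp: hom_lists_def dest: in_set_takeD in_set_dropD)

text \<open>A map of degree e moves past i inputs, each of degree 1, which gives the sign with
  exponent \<open>e * int i\<close>; coefficients multiply.\<close>

lemma end_op_comp_line_map:
  fixes b c :: "'k::field"
  assumes i: "i < m" and d: "d = 1 - int m \<or> b = 0" and e: "e = 1 - int n \<or> c = 0"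
  shows "op_comp (end_op (conc 1)) m n i d e (line_map m b) (line_map n c) =
    line_map (m + n - 1) ((-1) powi (e * int i) * b * c)"
proof -
  have "(let ys = take n (drop i xs); u = degsum ys in
      scl ((-1) powi (e * degsum (take i xs)))
        (hap (line_map m b) (a + e) (ptens (take i xs @ (u + e, hap (line_map n c) u (ptens ys)) # drop (i + n) xs)))) =
      (\<lambda>_. (-1) powi (e * int i) * b * c * cprod xs)"
    if xs: "xs \<in> hom_lists (conc 1) (m + n - 1) a" for a and xs :: "(int \<times> (unit \<Rightarrow> 'k)) list"
  proof -
    define us where "us = take i xs"
    define ys where "ys = take n (drop i xs)"
    define vs where "vs = drop (i + n) xs"
    define u where "u = degsum ys"
    have split: "xs = us @ ys @ vs"
      unfolding us_def ys_def vs_def by (metis append_take_drop_id drop_drop add.commute)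
    have us: "us \<in> hom_lists (conc 1) i (degsum us)"
      unfolding us_def using hom_lists_take_drop(1)[OF xs] i by simp
    have vs: "vs \<in> hom_lists (conc 1) (m - 1 - i) (degsum vs)"
      unfolding vs_def using hom_lists_take_drop(2)[OF xs, of "i + n"] i by simp
    have "drop i xs \<in> hom_lists (conc 1) (m + n - 1 - i) (degsum (drop i xs))"
      using hom_lists_take_drop(2)[OF xs, of i] i by simp
    from hom_lists_take_drop(1)[OF this, of n] have ys: "ys \<in> hom_lists (conc 1) n u"
      unfolding ys_def u_def using i by simp
    have g: "hap (line_map n c) u (ptens ys) = (\<lambda>_. c * cprod ys)" by (rule hap_line_map[OF ys])
    \<comment> \<open>The entry produced by the inner map must be homogeneous for the outer one to
      be evaluated: either it is in degree n + (1 - n) = 1, or it is zero and lies in every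
      degree.\<close>
    have "u + e = 1 \<or> c * cprod ys = 0"
      using e cprod_nonzero(2)[OF ys] by auto
    then have "[(u + e, \<lambda>_. c * cprod ys)] \<in> hom_lists (conc 1) 1 (u + e)"
      by (auto simp: hom_lists_def conc_def degsum_def)
    from hom_lists_append[OF us hom_lists_append[OF this vs]]
    have "us @ (u + e, \<lambda>_. c * cprod ys) # vs \<in> hom_lists (conc 1) (i + (1 + (m - 1 - i))) (degsum us + (u + e + degsum vs))"
      by simp
    moreover have "a = degsum us + u + degsum vs"
      using xs unfolding split u_def by (simp add: hom_lists_def degsum_def)
    ultimately have "us @ (u + e, \<lambda>_. c * cprod ys) # vs \<in> hom_lists (conc 1) m (a + e)"
      using i by (simp add: algebra_simps)
    note f = hap_line_map[OF this, of b]
    \<comment> \<open>The sign in the definition uses the actual degree of the preceding inputs; it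
      can differ from i only when both sides vanish.\<close>
    have "cprod us = 0 \<or> degsum us = int i"
      using cprod_nonzero(2)[OF us] by auto
    then show ?thesis
      unfolding Let_def us_def[symmetric] ys_def[symmetric] vs_def[symmetric] u_def[symmetric] g f
      by (auto simp: split cprod_append cprod_Cons scl_def fun_eq_iff)
  qed
  \<comment> \<open>(1 - m) + (1 - n) = 1 - (m + n - 1), where m > 0 keeps the subtraction from
    truncating.\<close>
  moreover have "d + e = 1 - int (m + n - 1) \<or> (-1) powi (e * int i) * b * c = 0"
    using d e i by auto
  ultimately show ?thesis
    unfolding end_op_def Let_def dgop.simps
    by (intro the_line_map) (auto simp: Let_def)
qed

text \<open>The identity of k[1] is the map with coefficient 1; for n = 1 the degree 1 - n is 0, and
  the value at the generator excludes other coefficients.\<close>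

lemma end_op_unit: "op_unit (end_op (conc 1)) = line_map 1 (1 :: 'k::field)"
  unfolding end_op_def Let_def dgop.simps
proof (rule the_equality)
  have mem: "[(a, x)] \<in> hom_lists (conc 1) 1 a" if "x \<in> grade (conc 1) a" for a and x :: "unit \<Rightarrow> 'k"
    using that by (simp add: hom_lists_def degsum_def)
  have eq: "hap (line_map 1 c) a (ptens [(a, x)]) = scl c x" if "x \<in> grade (conc 1) a" for a c and x :: "unit \<Rightarrow> 'k"
    unfolding hap_line_map[OF mem[OF that]] by (simp add: cprod_def scl_def fun_eq_iff)
  show "line_map 1 1 \<in> grade (hom_cpx (tpow (conc 1) 1) (conc 1 :: ('k, unit) cpx)) 0 \<and>
    (\<forall>a. \<forall>x\<in>grade (conc 1) a. hap (line_map 1 (1 :: 'k)) a (ptens [(a, x)]) = x)"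
  proof (intro conjI allI ballI)
    show "line_map 1 1 \<in> grade (hom_cpx (tpow (conc 1) 1) (conc 1 :: ('k, unit) cpx)) 0"
      by (simp add: grade_end_conc del: One_nat_def)
    fix a and x :: "unit \<Rightarrow> 'k" assume "x \<in> grade (conc 1) a"
    from eq[OF this, of 1] show "hap (line_map 1 (1 :: 'k)) a (ptens [(a, x)]) = x" by simp
  qed
  fix U assume U: "U \<in> grade (hom_cpx (tpow (conc 1) 1) (conc 1 :: ('k, unit) cpx)) 0 \<and>
    (\<forall>a. \<forall>x\<in>grade (conc 1) a. hap U a (ptens [(a, x)]) = x)"
  then have "U \<in> line_map 1 ` {c. 0 = 1 - int 1 \<or> c = 0}" unfolding grade_end_conc by blast
  then obtain c where c: "U = line_map 1 c" by blast
  have one: "(\<lambda>_. 1) \<in> grade (conc 1 :: ('k, unit) cpx) 1" by (simp add: grade_conc)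
  have "(\<lambda>_. 1) = hap U 1 (ptens [(1, \<lambda>_. 1 :: 'k)])" using U one by simp
  also have "\<dots> = scl c (\<lambda>_. 1)" unfolding c by (rule eq[OF one])
  finally have "c = 1" by (simp add: scl_def fun_eq_iff)
  then show "U = line_map 1 1" using c by simp
qed

lemma unit_line_end_op: "unit_line (end_op (conc 1 :: ('k::field, unit) cpx))"
proof -
  let ?E = "end_op (conc 1 :: ('k, unit) cpx)"
  have gr: "op_gr ?E n d = line_map n ` {c. d = 1 - int n \<or> c = 0}" for n d
    unfolding grade_end_conc[symmetric] by (simp add: end_op_def Let_def)
  have sub: "fs.subspace (op_gr ?E n d)" for n d
    unfolding gr by (rule subspace_line_map)
  have bd0: "op_bd ?E n d F = 0" if F: "F \<in> op_gr ?E n d" for n d F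
  proof -
    obtain c where c: "F = line_map n c" using F by (auto simp: gr)
    \<comment> \<open>F vanishes on all degrees but n, so only a = n + 1 matters; there the tensor
      power is zero. The other term of the differential vanishes with the differential of
      k[1].\<close>
    have van: "hap F (a - 1) (bdry (tpow (conc 1) n) a x) = 0" if "x \<in> grade (tpow (conc 1 :: ('k, unit) cpx) n) a" for a x
    proof (cases "a = int n + 1")
      case True
      then have "ptens xs = 0" if "xs \<in> hom_lists (conc 1 :: ('k, unit) cpx) n a" for xs
        using that cprod_nonzero[of xs n a] ptens_eq_scl_ones[OF that] by (cases "cprod xs = 0") auto
      then have "grade (tpow (conc 1 :: ('k, unit) cpx) n) a \<subseteq> {0}"
        unfolding grade_tpow by (intro fs.span_minimal fs.subspace_single_0) auto
      then have "x = 0" using that by auto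
      then show ?thesis by (auto simp: bdry_tpow_conc_zero c hap_def line_map_def)
    next
      case False
      then show ?thesis by (auto simp: c hap_def line_map_def fun_eq_iff)
    qed
    show ?thesis
    proof
      fix t :: "int \<times> ((int \<times> unit) list \<Rightarrow> 'k) \<times> unit"
      obtain a x j where t: "t = (a, x, j)" by (cases t)
      show "op_bd ?E n d F t = 0 t"
        by (cases "x \<in> grade (tpow (conc 1 :: ('k, unit) cpx) n) a")
          (simp_all add: t end_op_def Let_def hom_cpx_def bdry_conc van)
    qed
  qed
  show ?thesis
  proof unfold_locales
    fix n m :: nat and d e :: int and i :: nat and \<sigma> :: "nat \<Rightarrow> nat"
    show "fs.subspace (op_gr ?E n d)" by (rule sub)
    show "linear_on (op_gr ?E n d) (op_bd ?E n d)"
      using fs.subspace_add[OF sub] fs.subspace_scale[OF sub] by (auto simp: linear_on_def bd0)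
    show "linear_on (op_gr ?E n d) (op_act ?E n \<sigma> d)" if \<sigma>: "\<sigma> permutes {..<n}"
      unfolding gr by (rule linear_on_line_map) (rule end_op_act_line_map[OF \<sigma>])
    show "bilinear_on (op_gr ?E m d) (op_gr ?E n e) (op_comp ?E m n i d e)" if i: "i < m"
      unfolding bilinear_on_def
    proof (intro conjI ballI)
      fix F assume "F \<in> op_gr ?E m d"
      then obtain b where b: "F = line_map m b" "d = 1 - int m \<or> b = 0" by (auto simp: gr)
      show "linear_on (op_gr ?E n e) (op_comp ?E m n i d e F)"
        unfolding gr b(1) by (rule linear_on_line_map) (rule end_op_comp_line_map[OF i b(2)])
    next
      fix G assume "G \<in> op_gr ?E n e"
      then obtain c where c: "G = line_map n c" "e = 1 - int n \<or> c = 0" by (auto simp: gr)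
      show "linear_on (op_gr ?E m d) (\<lambda>F. op_comp ?E m n i d e F G)"
        unfolding gr c(1)
        by (rule linear_on_line_map[where m = "m + n - 1" and k = "(-1) powi (e * int i) * c"], subst end_op_comp_line_map[OF i _ c(2)]) (simp_all add: mult.assoc mult.commute[of _ c])
    qed
    show "op_gr ?E 1 d = (if d = 0 then range (\<lambda>c. scl c (op_unit ?E)) else {0})"
      unfolding gr end_op_unit line_map_scl[symmetric] by (auto simp: line_map_0)
    show "op_unit ?E \<noteq> 0"
      using line_map_inject[of 1 "1 :: 'k" 0] by (simp add: end_op_unit line_map_0)
    show "op_bd ?E 1 0 (op_unit ?E) = 0"
      by (rule bd0) (simp add: gr end_op_unit del: One_nat_def)
    have "koszul id (ones 1 :: (int \<times> (unit \<Rightarrow> 'k)) list) = (1 :: 'k)"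
      unfolding koszul_def by (rule prod.neutral) auto
    then show "op_act ?E 1 id 0 (op_unit ?E) = op_unit ?E"
      unfolding end_op_unit using end_op_act_line_map[OF permutes_id, of 0 1 "1 :: 'k"] by simp
    show "op_comp ?E 1 1 0 0 0 (op_unit ?E) (op_unit ?E) = op_unit ?E"
      unfolding end_op_unit using end_op_comp_line_map[of 0 1 0 "1 :: 'k" 0 1 1] by simp
  qed
qed


section \<open>The tower of suspensions and its limit\<close>

text \<open>On a source satisfying \<open>unit_line\<close> these properties determine all values of
  the map on the graded pieces: it is zero outside arity one and transfers the coefficient of the
  unit within it.\<close>

locale unit_projection =
  fixes P :: "('k::field, 'i) dgop" and Q :: "('k, 'j) dgop" and \<phi> :: "('k, 'i, 'j) opmap"
  assumes linear: "linear_on (op_gr P n d) (\<phi> n d)"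
    and vanishes: "n \<noteq> 1 \<Longrightarrow> x \<in> op_gr P n d \<Longrightarrow> \<phi> n d x = 0"
    and unit: "\<phi> 1 0 (op_unit P) = op_unit Q"

lemma unit_projection_reindex:
  fixes P :: "('k::field, 'i) dgop" and Q :: "('k, 'j) dgop"
  assumes "unit_projection P Q \<phi>" "inj \<iota>"
  shows "unit_projection (reindex \<iota> P) (reindex \<kappa> Q) (reindex_map \<iota> \<kappa> \<phi>)"
proof -
  interpret unit_projection P Q \<phi> by fact
  show ?thesis
  proof
    show "linear_on (op_gr (reindex \<iota> P) n d) (reindex_map \<iota> \<kappa> \<phi> n d)" for n d
      using linear_on_push[OF assms(2) linear, of n d \<kappa>]
      by (simp add: reindex_def reindex_map_def[abs_def])
    show "n \<noteq> 1 \<Longrightarrow> x \<in> op_gr (reindex \<iota> P) n d \<Longrightarrow> reindex_map \<iota> \<kappa> \<phi> n d x = 0" for n x d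
      using vanishes assms(2) by (auto simp: reindex_def reindex_map_def pull_push push_zero)
    show "reindex_map \<iota> \<kappa> \<phi> 1 0 (op_unit (reindex \<iota> P)) = op_unit (reindex \<kappa> Q)"
      using unit assms(2) by (simp add: reindex_def reindex_map_def pull_push)
  qed
qed

text \<open>On pure tensors the map applies \<open>\<phi>\<close> to the first factor, so it
  vanishes there whenever \<open>\<phi>\<close> does, and by linearity on their span.\<close>

lemma unit_projection_tensor:
  fixes P :: "('k::field, 'i) dgop" and P' :: "('k, 'l) dgop" and Q :: "('k, 'j) dgop"
  assumes "unit_line P" "unit_line Q" "unit_projection P P' \<phi>"
  shows "unit_projection (tensor_op P Q) (tensor_op P' Q) (tensor_map P Q \<phi> (\<lambda>n d x. x))"
proof -
  interpret P: unit_line P by fact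
  interpret Q: unit_line Q by fact
  interpret unit_projection P P' \<phi> by fact
  have gr: "op_gr (tensor_op P Q) n = tensor_gr (op_ar P n) (op_ar Q n)" for n
    by (simp add: tensor_op_def tensor_cpx_def)
  have bil: "bilinear_on (op_gr P n a) (op_gr Q n (d - a)) (\<lambda>x y. pten a (\<phi> n a x) y)" for n a d
    by (intro bilinear_on_pten linear linear_on_ident)
  note lift = tensor_lift_universal[OF P.subspace_gr Q.subspace_gr bil]
  show ?thesis
  proof
    show lin: "linear_on (op_gr (tensor_op P Q) n d) (tensor_map P Q \<phi> (\<lambda>n d x. x) n d)" for n d
      unfolding gr tensor_map_def by (rule lift(1))
    show "tensor_map P Q \<phi> (\<lambda>n d x. x) n d x = 0" if n: "n \<noteq> 1" and x: "x \<in> op_gr (tensor_op P Q) n d" for n x d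
    proof (rule linear_on_span_eq[OF lin[unfolded gr tensor_gr_def] linear_on_const_zero _ x[unfolded gr tensor_gr_def]])
      fix t assume "t \<in> {pten a x y |a x y. x \<in> op_gr P n a \<and> y \<in> op_gr Q n (d - a)}"
      then show "tensor_map P Q \<phi> (\<lambda>n d x. x) n d t = 0"
        using n by (auto simp: tensor_map_def lift(2) vanishes)
    qed
    have "op_unit Q \<in> op_gr Q 1 (0 - 0)" using Q.unit_in_gr by simp
    from lift(2)[OF P.unit_in_gr this]
    show "tensor_map P Q \<phi> (\<lambda>n d x. x) 1 0 (op_unit (tensor_op P Q)) = op_unit (tensor_op P' Q)"
      by (simp add: tensor_map_def tensor_op_def unit[unfolded One_nat_def])
  qed
qed

section \<open>The limit of a tower of such maps\<close>

lemma constant_like_lim_op: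
  fixes S :: "nat \<Rightarrow> ('k::field, 'i) dgop"
  assumes S: "\<And>r. unit_line (S r)" and \<psi>: "\<And>r. unit_projection (S (Suc r)) (S r) (\<psi> r)"
  shows "constant_like (lim_op S \<psi>)"
proof -
  let ?L = "lim_op S \<psi>"
  have term_seq: "term_at (seq f) r = f r" for f :: "nat \<Rightarrow> 'i \<Rightarrow> 'k" and r
    by (simp add: term_at_def seq_def)
  have seq_eqI: "x = y" if "\<And>r. term_at x r = term_at y r" for x y :: "nat \<times> 'i \<Rightarrow> 'k"
    using that by (auto simp: term_at_def fun_eq_iff)
  have term_scl: "term_at (scl c x) r = scl c (term_at x r)" for c r and x :: "nat \<times> 'i \<Rightarrow> 'k"
    by (simp add: term_at_def scl_def)
  have term_0: "term_at 0 r = (0 :: 'i \<Rightarrow> 'k)" for r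
    by (simp add: term_at_def fun_eq_iff)
  have unit: "term_at (op_unit ?L) r = op_unit (S r)" for r
    by (simp add: lim_op_def term_seq)
  have bd: "term_at (op_bd ?L n d x) r = op_bd (S r) n d (term_at x r)" for n d x r
    by (simp add: lim_op_def term_seq)
  have act: "term_at (op_act ?L n \<sigma> d x) r = op_act (S r) n \<sigma> d (term_at x r)" for n d x r \<sigma>
    by (simp add: lim_op_def term_seq)
  have comp: "term_at (op_comp ?L m n i d e x y) r = op_comp (S r) m n i d e (term_at x r) (term_at y r)"
    for m n i d e x y r
    by (simp add: lim_op_def term_seq)
  have mem: "x \<in> op_gr ?L n d \<longleftrightarrow>
      (\<forall>r. term_at x r \<in> op_gr (S r) n d \<and> \<psi> r n d (term_at x (Suc r)) = term_at x r)" for x n d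
    by (simp add: lim_op_def)
  note lin = unit_projection.linear[OF \<psi>] and van = unit_projection.vanishes[OF \<psi>]
    and \<psi>_unit = unit_projection.unit[OF \<psi>]
  have \<psi>_scl: "\<psi> r 1 0 (scl c (op_unit (S (Suc r)))) = scl c (op_unit (S r))" for r c
    using linear_onD(2)[OF lin unit_line.unit_in_gr[OF S]] \<psi>_unit by simp
  have zero: "0 \<in> op_gr ?L n d" for n d
    using linear_on_zero[OF lin unit_line.zero_in_gr[OF S]] unit_line.zero_in_gr[OF S]
    by (simp add: mem term_0)
  have scl_mem: "scl c (op_unit (S r)) \<in> op_gr (S r) 1 0" for c r
    by (rule fs.subspace_scale[OF unit_line.subspace_gr[OF S] unit_line.unit_in_gr[OF S]])
  have gr: "op_gr ?L n d = (if n = 1 \<and> d = 0 then range (\<lambda>c. scl c (op_unit ?L)) else {0})" for n d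
  proof (cases "n = 1 \<and> d = 0")
    case True
    have "scl c (op_unit ?L) \<in> op_gr ?L 1 0" for c
      unfolding mem term_scl unit using scl_mem \<psi>_scl by blast
    moreover have "x \<in> range (\<lambda>c. scl c (op_unit ?L))" if x: "x \<in> op_gr ?L 1 0" for x
    proof -
      have "\<forall>r. \<exists>c. term_at x r = scl c (op_unit (S r))"
        using x unfolding mem unit_line.gr_one[OF S] by auto
      then obtain c where c: "\<And>r. term_at x r = scl (c r) (op_unit (S r))" by metis
      have "c (Suc r) = c r" for r
      proof -
        \<comment> \<open>Compatibility compares two multiples of one nonzero unit, so successive
          coefficients agree and one scalar describes the whole sequence.\<close>
        have "scl (c (Suc r)) (op_unit (S r)) = scl (c r) (op_unit (S r))"
          using x unfolding mem c \<psi>_scl by blast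
        then show ?thesis using unit_line.unit_nonzero[OF S] by (simp add: fs.scale_cancel_right)
      qed
      then have "c r = c 0" for r by (induction r) auto
      then have "x = scl (c 0) (op_unit ?L)"
        by (intro seq_eqI) (metis c term_scl unit)
      then show ?thesis by blast
    qed
    ultimately show ?thesis using True by auto
  next
    case False
    have "x = 0" if x: "x \<in> op_gr ?L n d" for x
    proof (rule seq_eqI)
      fix r
      show "term_at x r = term_at 0 r"
      proof (cases "n = 1")
        case True
        then show ?thesis using x False unfolding mem term_0
          by (auto simp: unit_line.gr_one[OF S] simp del: One_nat_def)
      next
        case False
        \<comment> \<open>The operad at stage r may be nonzero in this arity, but the r-th term is
          the image of the next one under a map that vanishes there.\<close>
        then show ?thesis using x van unfolding mem term_0 by metis
      qed
    qed
    then show ?thesis using False zero by auto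
  qed
  have cases: "x = 0 \<or> (n = 1 \<and> d = 0 \<and> (\<exists>c. x = scl c (op_unit ?L)))" if "x \<in> op_gr ?L n d" for x n d
    using that by (auto simp: gr split: if_splits)
  show ?thesis
  proof
    show "op_gr ?L n d = (if n = 1 \<and> d = 0 then range (\<lambda>c. scl c (op_unit ?L)) else {0})" for n d
      by (rule gr)
    show "op_unit ?L \<noteq> 0" using unit[of 0] unit_line.unit_nonzero[OF S, of 0] term_0 by metis
    show "op_bd ?L n d x = 0" if "x \<in> op_gr ?L n d" for n d x
    proof (rule seq_eqI)
      fix r
      have "op_bd (S r) 1 0 (scl c (op_unit (S r))) = 0" for c
        using linear_onD(2)[OF unit_line.bd_linear[OF S] unit_line.unit_in_gr[OF S]] unit_line.bd_unit[OF S] by simp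
      then show "term_at (op_bd ?L n d x) r = term_at 0 r"
        using cases[OF that] by (auto simp: bd term_0 term_scl unit unit_line.bd_zero[OF S] simp del: One_nat_def)
    qed
    show "op_act ?L n \<sigma> d x = x" if \<sigma>: "\<sigma> permutes {..<n}" and x: "x \<in> op_gr ?L n d" for n \<sigma> d x
    proof (rule seq_eqI)
      fix r
      have "op_act (S r) 1 id 0 (scl c (op_unit (S r))) = scl c (op_unit (S r))" for c
        using linear_onD(2)[OF unit_line.act_linear[OF S permutes_id] unit_line.unit_in_gr[OF S]]
          unit_line.act_unit[OF S] by simp
      \<comment> \<open>The action on the unit is known for the identity, the only permutation of
        one input.\<close>
      moreover have "\<sigma> = id" if "n = 1"
        using \<sigma> that by (simp add: lessThan_Suc)
      ultimately show "term_at (op_act ?L n \<sigma> d x) r = term_at x r"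
        using cases[OF x] unit_line.act_zero[OF S \<sigma>]
        by (auto simp: act term_0 term_scl unit simp del: One_nat_def)
    qed
    show "op_comp ?L m n i d e x 0 = 0" if "i < m" "x \<in> op_gr ?L m d" for m n i d e x
      using that unit_line.comp_zero(1)[OF S] by (intro seq_eqI) (simp add: comp term_0 mem)
    show "op_comp ?L m n i d e 0 y = 0" if "i < m" "y \<in> op_gr ?L n e" for m n i d e y
      using that unit_line.comp_zero(2)[OF S] by (intro seq_eqI) (simp add: comp term_0 mem)
    show "op_comp ?L 1 1 0 0 0 (scl a (op_unit ?L)) (scl b (op_unit ?L)) = scl (a * b) (op_unit ?L)" for a b
    proof (rule seq_eqI)
      fix r
      let ?u = "op_unit (S r)" and ?c = "op_comp (S r) 1 1 0 0 0"
      have bil: "bilinear_on (op_gr (S r) 1 0) (op_gr (S r) 1 0) ?c"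
        by (rule unit_line.comp_bilinear[OF S]) simp
      have u: "?u \<in> op_gr (S r) 1 0" by (rule unit_line.unit_in_gr[OF S])
      have "?c (scl a ?u) (scl b ?u) = scl b (?c (scl a ?u) ?u)"
        using bil scl_mem u unfolding bilinear_on_def by (meson linear_onD(2))
      also have "?c (scl a ?u) ?u = scl a (?c ?u ?u)"
        using bil u unfolding bilinear_on_def linear_on_def by blast
      finally show "term_at (op_comp ?L 1 1 0 0 0 (scl a (op_unit ?L)) (scl b (op_unit ?L))) r =
          term_at (scl (a * b) (op_unit ?L)) r"
        unfolding comp term_scl unit by (simp add: unit_line.comp_unit[OF S, unfolded One_nat_def] mult.commute)
    qed
  qed
qed

section \<open>The suspensions of Comm and their stabilization maps\<close>

lemma unit_line_comm_susp: "unit_line (comm_susp r)"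
proof (induction r)
  case 0
  show ?case
    unfolding comm_susp_def funpow_0
    by (rule unit_line_reindex[OF unit_line_comm_op]) (auto simp: inj_def)
next
  case (Suc r)
  then show ?case
    using unit_line_reindex[OF unit_line_tensor_op[OF Suc unit_line_end_op] inj_sidx_cons]
    by (simp add: comm_susp_def susp_def)
qed

lemma linear_on_line:
  assumes "\<And>c. f (scl c u) = scl c v"
  shows "linear_on (range (\<lambda>c. scl c u)) f"
  unfolding linear_on_def
proof (intro conjI ballI allI)
  fix x y b assume "x \<in> range (\<lambda>c. scl c u)"
  then obtain c where x: "x = scl c u" by blast
  show "f (scl b x) = scl b (f x)"
    unfolding x fs.scale_scale assms ..
  assume "y \<in> range (\<lambda>c. scl c u)"
  then obtain c' where y: "y = scl c' u" by blast
  show "f (x + y) = f x + f y"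
    unfolding x y fs.scale_left_distrib[symmetric] assms ..
qed

lemma unit_projection_stabilization:
  "unit_projection (comm_susp 1) (comm_susp 0) (stabilization :: ('k::field, 'k sidx, 'k sidx) opmap)"
proof -
  interpret unit_line "comm_susp 1 :: ('k, 'k sidx) dgop" by (rule unit_line_comm_susp)
  \<comment> \<open>The coefficient described by \<open>THE\<close> is unique because the unit of
    the suspension is nonzero.\<close>
  have eq: "stabilization 1 0 (scl c (op_unit (comm_susp 1))) = scl c (op_unit (comm_susp 0))" for c :: 'k
    using unit_nonzero by (simp add: stabilization_def fs.scale_cancel_right del: One_nat_def)
  show ?thesis
  proof
    show "linear_on (op_gr (comm_susp 1) n d) (stabilization n d :: ('k sidx \<Rightarrow> 'k) \<Rightarrow> _)" for n d
    proof (cases "n = 1 \<and> d = 0")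
      case True
      then show ?thesis
        using linear_on_line[OF eq] by (simp add: gr_one del: One_nat_def)
    next
      case False
      then show ?thesis by (auto simp: stabilization_def linear_on_def)
    qed
    show "n \<noteq> 1 \<Longrightarrow> (stabilization n d x :: 'k sidx \<Rightarrow> 'k) = 0" for n d and x :: "'k sidx \<Rightarrow> 'k"
      by (simp add: stabilization_def)
    show "stabilization 1 0 (op_unit (comm_susp 1)) = (op_unit (comm_susp 0) :: 'k sidx \<Rightarrow> 'k)"
      using eq[of 1] by simp
  qed
qed

text \<open>Each further map is the previous one tensored with the identity of \<open>End\<close>
  and transported along \<open>sidx_cons\<close>; both steps preserve the property.\<close>

lemma unit_projection_stab_map: "unit_projection (comm_susp (Suc r)) (comm_susp r) (stab_map r)"
proof (induction r)
  case 0
  show ?case using unit_projection_stabilization by simp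
next
  case (Suc r)
  from unit_projection_reindex[OF unit_projection_tensor[OF unit_line_comm_susp unit_line_end_op Suc] inj_sidx_cons]
  show ?case by (simp add: comm_susp_def susp_def susp_map_def)
qed

lemma constant_like_comm_st: "constant_like comm_st"
  unfolding comm_st_def
  by (intro constant_like_lim_op unit_line_comm_susp unit_projection_stab_map)


theorem proposition2p38:
  shows "chain_operad_iso (comm_st :: ('k::field, nat \<times> 'k sidx) dgop) (const_op :: ('k, unit) dgop) \<and>
    cochain_operad_iso (op_dagger (comm_st :: ('k, nat \<times> 'k sidx) dgop)) (op_dagger (const_op :: ('k, unit) dgop))"
  by (intro conjI constant_like_iso constant_like.dagger constant_like_comm_st constant_like_const_op)

end
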